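(* The set $\mathbf{UEI}$ of uniquely ergodic subshifts $X$ for which the only rational values of $\mu_X(E)$, $E\subset X$ clopen, are $0$ and $1$ is residual in $\overline{\mathbf{TT}'}$; that is, $\mathbf{UEI}\cap\overline{\mathbf{TT}'}$ contains a dense $G_\delta$ subset of $\overline{\mathbf{TT}'}$.
   Context: A subshift is a nonempty compact set $X\subset\mathbb{Z}^{\mathbb{Z}}$ (product topology, $\mathbb{Z}$ discrete) with $\sigma(X)=X$, where $(\sigma x)_i=x_{i+1}$; it is automatically over a finite alphabet. $L_n(X)$ is the set of $n$-letter words occurring in points of $X$. $\mathbf{S}$ is the set of all subshifts with the metric $d(X,Y)=2^{-\inf\{n:L_n(X)\ne L_n(Y)\}}$ ($d(X,X)=0$). $X$ is totally transitive if for every $n\ge1$ there is $x\in X$ with $\{\sigma^{in}x\}_{i\in\mathbb{Z}}$ dense in $X$; $\mathbf{TT}'$ is the set of infinite totally transitive subshifts and $\overline{\mathbf{TT}'}$ is its closure in $\mathbf{S}$. For uniquely ergodic $X$, $\mu_X$ is its unique $\sigma$-invariant Borel probability measure. *)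

theory Defs
  imports "HOL-Probability.Probability"
begin

text \<open>
  Points of \<open>\<int>\<^sup>\<int>\<close> are functions \<^typ>\<open>int \<Rightarrow> int\<close>; the library topology on this type is the
  product topology (\<open>euclidean_product_topology\<close>), and \<^typ>\<open>int\<close> carries the discrete
  topology (class \<^class>\<open>discrete_topology\<close>).
\<close>

definition shift :: "(int \<Rightarrow> int) \<Rightarrow> int \<Rightarrow> int" where
  "shift x = (\<lambda>i. x (i + 1))"

text \<open>The power \<open>\<sigma>\<^sup>k\<close> of the shift for an arbitrary integer \<open>k\<close>; see the lemmas below.\<close>

definition shift_by :: "int \<Rightarrow> (int \<Rightarrow> int) \<Rightarrow> int \<Rightarrow> int" where
  "shift_by k x = (\<lambda>i. x (i + k))"

lemma shift_by_0: "shift_by 0 = id"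
  by (auto simp: shift_by_def)

lemma shift_by_1: "shift_by 1 = shift"
  by (auto simp: shift_by_def shift_def fun_eq_iff)

lemma shift_by_add: "shift_by (k + l) x = shift_by k (shift_by l x)"
  by (auto simp: shift_by_def fun_eq_iff add.assoc)

lemma shift_by_of_nat: "shift_by (int n) = shift ^^ n"
proof (induction n)
  case (Suc n)
  have "shift_by (int (Suc n)) x = shift (shift_by (int n) x)" for x
    using shift_by_add[of 1 "int n" x] by (simp add: shift_by_1)
  then show ?case
    using Suc by (simp add: fun_eq_iff)
qed (simp add: shift_by_0)

lemma shift_by_minus: "shift_by (- int n) = inv (shift ^^ n)"
proof -
  have "inv (shift_by (int n)) = shift_by (- int n)"
    by (rule inv_unique_comp) (auto simp: fun_eq_iff shift_by_def)
  then show ?thesis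
    by (simp add: shift_by_of_nat)
qed

definition subshifts :: "(int \<Rightarrow> int) set set" where
  "subshifts = {X. X \<noteq> {} \<and> compact X \<and> shift ` X = X}"

definition words :: "nat \<Rightarrow> (int \<Rightarrow> int) set \<Rightarrow> int list set" where
  "words n X = {map (\<lambda>j. x (k + int j)) [0..<n] | x k. x \<in> X}"

definition subshift_dist :: "(int \<Rightarrow> int) set \<Rightarrow> (int \<Rightarrow> int) set \<Rightarrow> real" where
  "subshift_dist X Y =
     (if X = Y then 0 else 2 powr (- real (Inf {n. words n X \<noteq> words n Y})))"

lemma shift_by_mem_subshift:
  assumes X: "X \<in> subshifts" and x: "x \<in> X"
  shows "shift_by k x \<in> X"
proof -
  have im: "shift ` X = X"
    using X by (simp add: subshifts_def)
  have fwd: "(shift ^^ n) y \<in> X" if "y \<in> X" for n y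
    using that im by (induction n) auto
  have imn: "(shift ^^ n) ` X = X" for n
  proof (induction n)
    case (Suc n)
    have "(shift ^^ Suc n) ` X = shift ` ((shift ^^ n) ` X)"
      by (auto simp: image_image)
    then show ?case
      using Suc im by simp
  qed simp
  show ?thesis
  proof (cases "k \<ge> 0")
    case True
    then show ?thesis
      using fwd[OF x, of "nat k"] shift_by_of_nat[of "nat k"] by simp
  next
    case False
    obtain y where y: "y \<in> X" "x = (shift ^^ nat (- k)) y"
      using imn[of "nat (- k)"] x by blast
    have "x = shift_by (- k) y"
      using y False shift_by_of_nat[of "nat (- k)"] by simp
    then have "shift_by k x = y"
      by (simp add: shift_by_def fun_eq_iff)
    then show ?thesis
      using y by simp
  qed
qed

lemma closed_subshift:
  assumes "X \<in> subshifts"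
  shows "closed X"
proof -
  have "Hausdorff_space (euclidean :: int topology)"
    unfolding Hausdorff_space_def disjnt_def
    by (auto intro!: exI[of _ "{_}"] simp: discrete_topology_class.open_discrete)
  then have "Hausdorff_space (product_topology (\<lambda>_. euclidean) UNIV :: (int \<Rightarrow> int) topology)"
    by (simp add: Hausdorff_space_product_topology)
  then have "Hausdorff_space (euclidean :: (int \<Rightarrow> int) topology)"
    by (simp add: euclidean_product_topology)
  moreover have "compactin euclidean X"
    using assms by (simp add: subshifts_def)
  ultimately have "closedin euclidean X"
    by (rule compactin_imp_closedin)
  then show ?thesis
    by simp
qed

text \<open>This is what makes the infimum in \<^const>\<open>subshift_dist\<close> well defined for distinct subshifts.\<close>

lemma words_determine_subshift_le:
  assumes X: "X \<in> subshifts" and Y: "Y \<in> subshifts" and eq: "\<And>n. words n X = words n Y"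
  shows "X \<subseteq> Y"
proof (rule subsetI, rule ccontr)
  fix x assume x: "x \<in> X" "x \<notin> Y"
  have "openin (product_topology (\<lambda>_. euclidean) UNIV) (- Y)"
    using closed_subshift[OF Y] by (simp add: euclidean_product_topology open_Compl)
  from product_topology_open_contains_basis[OF this, of x] x
  obtain U where U: "x \<in> Pi\<^sub>E UNIV U" "finite {i. U i \<noteq> topspace euclidean}" "Pi\<^sub>E UNIV U \<subseteq> - Y"
    by auto
  obtain N :: nat where N: "\<And>i. U i \<noteq> UNIV \<Longrightarrow> \<bar>i\<bar> \<le> int N"
  proof -
    have "finite ((\<lambda>i. nat \<bar>i\<bar>) ` {i. U i \<noteq> UNIV})"
      using U by simp
    then obtain N where "\<forall>m \<in> (\<lambda>i. nat \<bar>i\<bar>) ` {i. U i \<noteq> UNIV}. m \<le> N"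
      using finite_nat_set_iff_bounded_le by blast
    then show ?thesis
      using that[of N] by fastforce
  qed
  have "map (\<lambda>j. x (- int N + int j)) [0..<2*N+1] \<in> words (2*N+1) X"
    using x unfolding words_def by blast
  then have "map (\<lambda>j. x (- int N + int j)) [0..<2*N+1] \<in> words (2*N+1) Y"
    by (simp only: eq)
  then obtain y k where y: "y \<in> Y"
      "map (\<lambda>j. x (- int N + int j)) [0..<2*N+1] = map (\<lambda>j. y (k + int j)) [0..<2*N+1]"
    unfolding words_def by blast
  have xy: "x (- int N + int j) = y (k + int j)" if "j < 2*N+1" for j
    using y(2) that unfolding map_eq_conv by (metis atLeastLessThan_iff atLeastLessThan_upt zero_le)
  define z where "z = shift_by (k + int N) y"
  have zY: "z \<in> Y"
    using y(1) Y shift_by_mem_subshift z_def by blast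
  have "z i \<in> U i" for i
  proof (cases "U i = UNIV")
    case False
    then have i: "\<bar>i\<bar> \<le> int N" using N by blast
    then have "nat (i + int N) < 2*N+1"
      by linarith
    with i have "x i = z i"
      using xy[of "nat (i + int N)"] by (simp add: z_def shift_by_def abs_le_iff algebra_simps)
    then show ?thesis using U(1) by (metis PiE_mem UNIV_I)
  qed simp
  then show False
    using U(3) zY by (auto simp: PiE_UNIV_domain)
qed

lemma words_determine_subshift:
  assumes "X \<in> subshifts" "Y \<in> subshifts" "\<And>n. words n X = words n Y"
  shows "X = Y"
  using assms words_determine_subshift_le by (metis subset_antisym)

interpretation subshift_space: Metric_space subshifts subshift_dist
proof
  fix X Y Z :: "(int \<Rightarrow> int) set"
  show "0 \<le> subshift_dist X Y"
    by (simp add: subshift_dist_def)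
  show "subshift_dist X Y = subshift_dist Y X"
    by (simp add: subshift_dist_def eq_commute)
  show "subshift_dist X Y = 0 \<longleftrightarrow> X = Y"
    by (simp add: subshift_dist_def)
  assume X: "X \<in> subshifts" and Y: "Y \<in> subshifts" and Z: "Z \<in> subshifts"
  have nn: "0 \<le> subshift_dist A B" for A B
    by (simp add: subshift_dist_def)
  show "subshift_dist X Z \<le> subshift_dist X Y + subshift_dist Y Z"
  proof (cases "X = Z \<or> X = Y \<or> Y = Z")
    case True
    then show ?thesis
      using nn by (auto simp: subshift_dist_def)
  next
    case False
    define D where "D A B = {n. words n A \<noteq> words n B}" for A B
    have "D X Z \<noteq> {}"
      using words_determine_subshift[OF X Z] False by (auto simp: D_def)
    then have "Inf (D X Z) \<in> D X Z"
      by (rule Inf_nat_def1)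
    then have "Inf (D X Z) \<in> D X Y \<or> Inf (D X Z) \<in> D Y Z"
      by (auto simp: D_def)
    then have "Inf (D X Y) \<le> Inf (D X Z) \<or> Inf (D Y Z) \<le> Inf (D X Z)"
      by (meson cInf_lower bdd_below_bot)
    then have "subshift_dist X Z \<le> subshift_dist X Y \<or> subshift_dist X Z \<le> subshift_dist Y Z"
      using False by (auto simp: subshift_dist_def D_def)
    then show ?thesis
      using nn[of X Y] nn[of Y Z] by linarith
  qed
qed

abbreviation subshift_topology :: "(int \<Rightarrow> int) set topology" where
  "subshift_topology \<equiv> subshift_space.mtopology"

definition totally_transitive :: "(int \<Rightarrow> int) set \<Rightarrow> bool" where
  "totally_transitive X \<longleftrightarrow>
     (\<forall>n::nat. n \<ge> 1 \<longrightarrow> (\<exists>x\<in>X. X \<subseteq> closure (range (\<lambda>i::int. shift_by (i * int n) x))))"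

definition infinite_totally_transitive :: "(int \<Rightarrow> int) set set" where
  "infinite_totally_transitive = {X \<in> subshifts. infinite X \<and> totally_transitive X}"

definition residual_in :: "'a topology \<Rightarrow> 'a set \<Rightarrow> bool" where
  "residual_in T A \<longleftrightarrow> (\<exists>G. gdelta_in T G \<and> T closure_of G = topspace T \<and> G \<subseteq> A)"

definition invariant_measure :: "(int \<Rightarrow> int) set \<Rightarrow> (int \<Rightarrow> int) measure \<Rightarrow> bool" where
  "invariant_measure X \<mu> \<longleftrightarrow>
     space \<mu> = X \<and> sets \<mu> = sets (restrict_space borel X) \<and> prob_space \<mu> \<and>
     (\<forall>A\<in>sets \<mu>. emeasure \<mu> (shift -` A \<inter> X) = emeasure \<mu> A)"

definition uniquely_ergodic :: "(int \<Rightarrow> int) set \<Rightarrow> bool" where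
  "uniquely_ergodic X \<longleftrightarrow> (\<exists>!\<mu>. invariant_measure X \<mu>)"

definition the_invariant_measure :: "(int \<Rightarrow> int) set \<Rightarrow> (int \<Rightarrow> int) measure" where
  "the_invariant_measure X = (THE \<mu>. invariant_measure X \<mu>)"

definition UEI :: "(int \<Rightarrow> int) set set" where
  "UEI = {X \<in> subshifts. uniquely_ergodic X \<and>
     (\<forall>E. openin (top_of_set X) E \<and> closedin (top_of_set X) E \<and>
          measure (the_invariant_measure X) E \<in> \<rat> \<longrightarrow>
          measure (the_invariant_measure X) E \<in> {0, 1})}"

end

theory Submission
  imports Defs "HOL-Library.Sublist"
begin

text \<open>
  Unique ergodicity and irrationality of the clopen measures follow together from one countable
  family of conditions.  For a cylinder \<open>E\<close> and a rational number \<open>r\<close> strictly between \<open>0\<close> and \<open>1\<close>,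
  say that a subshift decides \<open>E\<close> and \<open>r\<close> if for some \<open>N\<close> either every point visits \<open>E\<close> more than
  \<open>r N\<close> times up to time \<open>N\<close>, or every point does so fewer than \<open>r N\<close> times.  Integrating visit counts,
  the measures of \<open>E\<close> under all invariant measures lie strictly on one side of \<open>r\<close>.  A subshift that
  decides all pairs therefore has at most one invariant measure, since a rational number would lie
  between two different values, and no clopen set has a rational measure other than \<open>0\<close> and \<open>1\<close>.
  The same conditions force the visit frequencies to converge, and the limits extend from clopen
  sets to an invariant measure (\<open>exists_invariant_measure\<close>).

  Each condition depends only on the words of one length, so it is open.  The space of subshifts is
  complete (\<open>mcomplete_subshifts\<close>), and by the Baire category theorem it remains to see that every
  infinite totally transitive \<open>X\<close> can be approximated by one that decides a given pair
  (\<open>deciding_approximation\<close>).  Total transitivity of \<open>X\<close> yields a long word \<open>w\<close>, containing all words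
  of the length to be preserved, and two return words \<open>a\<close>, \<open>b\<close> to \<open>w\<close> with coprime lengths
  (\<open>coprime_return_words\<close>).  The frequency of visits to \<open>E\<close> cannot be equal to \<open>r\<close> for both: \<open>r\<close> times
  each length would be an integer, and then \<open>r\<close> would be an integer (\<open>nonzero_deviation\<close>).  Let
  \<open>c\<close> be the one with a frequency different from \<open>r\<close> and \<open>d\<close> the other.  All concatenations of
  \<open>c\<close> and \<open>c c ... c d\<close> with sufficiently many copies of \<open>c\<close> form, up to closure, a subshift in which
  every long word has frequency on the same side of \<open>r\<close>.  Its two blocks have coprime lengths, which
  makes it totally transitive (\<open>totally_transitive_coded\<close>).
\<close>

section \<open>Windows of points and the topology of the sequence space\<close>

definition window :: "(int \<Rightarrow> int) \<Rightarrow> int \<Rightarrow> nat \<Rightarrow> int list" where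
  "window x k n = map (\<lambda>j. x (k + int j)) [0..<n]"

lemma words_eq: "words n X = {window x k n | x k. x \<in> X}"
  by (simp add: words_def window_def)

lemma window_in_words: "x \<in> X \<Longrightarrow> window x k n \<in> words n X"
  by (auto simp: words_eq)

lemma length_window [simp]: "length (window x k n) = n"
  by (simp add: window_def)

lemma length_words: "u \<in> words n X \<Longrightarrow> length u = n"
  by (auto simp: words_eq)

lemma nth_window: "j < n \<Longrightarrow> window x k n ! j = x (k + int j)"
  by (simp add: window_def)

lemma window_add: "window x k (m + n) = window x k m @ window x (k + int m) n"
  by (intro nth_equalityI) (auto simp: nth_append nth_window algebra_simps of_nat_diff)

lemma window_shift_by: "window (shift_by l x) k n = window x (k + l) n"
  by (simp add: window_def shift_by_def algebra_simps)

lemma window_subst: "window x k (length (p @ u @ q)) = p @ u @ q \<Longrightarrow>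
    window x (k + int (length p)) (length u) = u"
  by (simp add: window_add)

lemma window_eq_iff: "window x k n = window y l n \<longleftrightarrow> (\<forall>j<n. x (k + int j) = y (l + int j))"
  by (auto simp: list_eq_iff_nth_eq nth_window)

lemma take_drop_window:
  "i + m \<le> n \<Longrightarrow> take m (drop i (window x k n)) = window x (k + int i) m"
  by (intro nth_equalityI) (auto simp: nth_window algebra_simps)

lemma sublist_window:
  assumes "k \<le> l" "l + int m \<le> k + int n"
  shows "sublist (window x l m) (window x k n)"
proof -
  have "window x l m = take m (drop (nat (l - k)) (window x k n))"
    using assms by (subst take_drop_window) auto
  then show ?thesis
    by (metis sublist_drop sublist_take sublist_order.dual_order.trans)
qed

lemma sublist_windowE:
  assumes "sublist u (window x k n)"
  obtains l where "k \<le> l" "l + int (length u) \<le> k + int n" "u = window x l (length u)"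
proof -
  obtain p q where pq: "window x k n = p @ u @ q"
    using assms by (auto simp: sublist_def)
  then have n: "n = length (p @ u @ q)"
    by (metis length_window)
  show ?thesis
    by (rule that[of "k + int (length p)"]) (use pq window_subst[of x k p u q] n in auto)
qed

lemma sublist_words:
  assumes "sublist u v" "v \<in> words n X"
  shows "u \<in> words (length u) X"
  using assms by (auto simp: words_eq elim!: sublist_windowE)

lemma words_mono_eq:
  assumes "words n X = words n Y" "m \<le> n"
  shows "words m X = words m Y"
proof -
  have "words m X \<subseteq> words m Y" if eq: "words n X = words n Y" for X Y
  proof
    fix u assume "u \<in> words m X"
    then obtain x k where x: "x \<in> X" and u: "u = window x k m"
      by (auto simp: words_eq)
    have "sublist u (window x k n)"
      unfolding u using \<open>m \<le> n\<close> by (intro sublist_window) auto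
    moreover have "window x k n \<in> words n Y"
      using x eq window_in_words by blast
    ultimately show "u \<in> words m Y"
      using sublist_words[of u "window x k n"] u by simp
  qed
  from this[OF assms(1)] this[OF assms(1)[symmetric]] show ?thesis
    by blast
qed

lemma words_at_origin:
  assumes "X \<in> subshifts"
  shows "words n X = {window x 0 n | x. x \<in> X}"
proof -
  have "\<exists>y\<in>X. window x k n = window y 0 n" if "x \<in> X" for x k
    using shift_by_mem_subshift[OF assms that, of k] by (metis window_shift_by add_0)
  then show ?thesis
    by (fastforce simp: words_eq)
qed

lemma open_cylinder: "open {y. window y k n = u}"
proof -
  have "open {y :: int \<Rightarrow> int. y i = c}" for i c
  proof -
    have "continuous_on UNIV (\<lambda>y :: int \<Rightarrow> int. y i)"
      by (rule continuous_on_product_coordinates)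
    then have "open ((\<lambda>y :: int \<Rightarrow> int. y i) -` {c})"
      by (rule open_vimage[rotated]) (rule discrete_topology_class.open_discrete)
    then show ?thesis
      by (simp add: vimage_def)
  qed
  moreover have "{y. window y k n = u} =
      (if length u = n then (\<Inter>j<n. {y. y (k + int j) = u ! j}) else {})"
    by (auto simp: list_eq_iff_nth_eq nth_window)
  ultimately show ?thesis
    by (auto intro!: open_INT)
qed

lemma open_cylinder_set: "open {y. window y k n \<in> W}"
proof -
  have "{y. window y k n \<in> W} = (\<Union>u\<in>W. {y. window y k n = u})"
    by auto
  then show ?thesis
    by (auto intro!: open_UN open_cylinder)
qed

lemma closed_cylinder_set: "closed {y. window y k n \<in> W}"
proof -
  have "- {y. window y k n \<in> W} = {y. window y k n \<in> - W}"
    by auto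
  then show ?thesis
    unfolding closed_def by (simp only: open_cylinder_set)
qed

lemma finite_words:
  assumes "X \<in> subshifts"
  shows "finite (words n X)"
proof -
  have "compact X"
    using assms by (simp add: subshifts_def)
  moreover have "X \<subseteq> (\<Union>u\<in>words n X. {y. window y 0 n = u})"
    by (auto intro: window_in_words)
  ultimately obtain T where T: "T \<subseteq> words n X" "finite T" "X \<subseteq> (\<Union>u\<in>T. {y. window y 0 n = u})"
    by (rule compactE_image[OF _ open_cylinder])
  then have "words n X \<subseteq> T"
    using words_at_origin[OF assms] by auto
  then show ?thesis
    using T(2) finite_subset by blast
qed

lemma cylinder_neighbourhood:
  assumes "open U" "x \<in> U"
  obtains K :: nat where
    "\<And>y. window y (- int K) (2 * K) = window x (- int K) (2 * K) \<Longrightarrow> y \<in> U"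
proof -
  have "openin (product_topology (\<lambda>_. euclidean) UNIV) U"
    using assms by (simp add: euclidean_product_topology)
  from product_topology_open_contains_basis[OF this \<open>x \<in> U\<close>]
  obtain V where V: "x \<in> Pi\<^sub>E UNIV V" "finite {i. V i \<noteq> topspace (euclidean :: int topology)}"
      "Pi\<^sub>E UNIV V \<subseteq> U"
    by auto
  obtain K where K: "\<forall>m \<in> (\<lambda>i. nat \<bar>i\<bar>) ` {i. V i \<noteq> UNIV}. m < K"
    using V(2) finite_nat_set_iff_bounded by (metis finite_imageI topspace_euclidean)
  show ?thesis
  proof (rule that)
    fix y assume y: "window y (- int K) (2 * K) = window x (- int K) (2 * K)"
    have "y i \<in> V i" for i
    proof (cases "V i = UNIV")
      case False
      then have i: "- int K < i" "i < int K"
        using K by force+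
      then have "y i = x i"
        using y[unfolded window_eq_iff, rule_format, of "nat (i + int K)"] by auto
      then show ?thesis
        using V(1) by (metis PiE_mem UNIV_I)
    qed simp
    then show "y \<in> U"
      using V(3) by (auto simp: PiE_UNIV_domain)
  qed
qed

section \<open>Subshifts given by a language\<close>

definition language_shift :: "int list set \<Rightarrow> (int \<Rightarrow> int) set" where
  "language_shift F = {x. \<forall>k n. window x k n \<in> F}"

text \<open>
  Each window condition is clopen, and bounding the alphabet places the points in a product of
  finite sets, which is compact.
\<close>

lemma language_shift_subshift:
  assumes "finite A" "\<And>u. u \<in> F \<Longrightarrow> set u \<subseteq> A" "language_shift F \<noteq> {}"
  shows "language_shift F \<in> subshifts"
proof -
  have "closed (language_shift F)"
  proof -
    have "language_shift F = (\<Inter>k. \<Inter>n. {x. window x k n \<in> F})"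
      by (auto simp: language_shift_def)
    then show ?thesis
      by (auto intro!: closed_INT closed_cylinder_set)
  qed
  moreover have "compact (PiE UNIV (\<lambda>_ :: int. A))"
  proof -
    have "compactin (product_topology (\<lambda>_. euclidean) UNIV) (PiE UNIV (\<lambda>_ :: int. A))"
      using \<open>finite A\<close> by (auto simp: compactin_PiE intro!: finite_imp_compact)
    then show ?thesis
      by (simp add: euclidean_product_topology)
  qed
  moreover have "language_shift F \<subseteq> PiE UNIV (\<lambda>_. A)"
  proof
    fix x assume "x \<in> language_shift F"
    then have "window x i 1 \<in> F" for i
      by (auto simp: language_shift_def)
    then have "x i \<in> A" for i
      using assms(2)[of "window x i 1"] by (auto simp: window_def)
    then show "x \<in> PiE UNIV (\<lambda>_. A)"
      by auto
  qed
  ultimately have "compact (language_shift F)"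
    by (metis closed_Int_compact inf.orderE inf_commute)
  moreover have "shift ` language_shift F = language_shift F"
  proof (intro equalityI subsetI)
    have inv: "shift_by l x \<in> language_shift F" if "x \<in> language_shift F" for l x
      using that by (auto simp: language_shift_def window_shift_by)
    then show "x \<in> language_shift F" if "x \<in> shift ` language_shift F" for x
      using that by (auto simp flip: shift_by_1)
    fix x assume x: "x \<in> language_shift F"
    have "x = shift (shift_by (-1) x)"
      by (simp add: shift_def shift_by_def)
    then show "x \<in> shift ` language_shift F"
      using inv[OF x] by blast
  qed
  ultimately show ?thesis
    using assms(3) by (simp add: subshifts_def)
qed

text \<open>
  The source of all points with prescribed windows below: words that grow on both sides converge
  to a bi-infinite point, because the position of each word relative to the origin stays fixed
  while later words only add letters further out.
\<close>

lemma nested_words_limit: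
  fixes u :: "nat \<Rightarrow> int list"
  assumes step: "\<And>k. u (Suc k) = p k @ u k @ q k" and ne: "\<And>k. p k \<noteq> []" "\<And>k. q k \<noteq> []"
  obtains x off where "\<And>k. window x (off k) (length (u k)) = u k"
    and "\<And>l n. \<exists>k. sublist (window x l n) (u k)"
proof -
  \<comment> \<open>The origin stays where \<open>u 0\<close> starts, so \<open>u k\<close> starts \<open>s k\<close> places to its left.\<close>
  define s where "s k = (\<Sum>j<k. length (p j))" for k
  have s_ge: "k \<le> s k" for k
  proof (induction k)
    case (Suc k)
    then show ?case
      using ne(1)[of k] by (simp add: s_def Suc_le_eq add_le_less_mono flip: length_greater_0_conv)
  qed simp
  have e_ge: "s k + k \<le> length (u k)" for k
  proof (induction k)
    case (Suc k)
    have "length (q k) \<ge> 1"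
      using ne(2)[of k] by (simp add: Suc_le_eq)
    with Suc show ?case
      by (simp add: s_def step)
  qed (simp add: s_def)
  have coherent: "u (k + d) ! (i + (s (k + d) - s k)) = u k ! i \<and> s k \<le> s (k + d)"
    if "i < length (u k)" for i k d
  proof (induction d)
    case (Suc d)
    have len: "i + (s (k + d) - s k) < length (u (k + d))"
    proof -
      have "length (u k) + (s (k + d) - s k) \<le> length (u (k + d)) \<and> s k \<le> s (k + d)"
        by (induction d) (auto simp: step s_def)
      then show ?thesis
        using that by linarith
    qed
    have "s (k + Suc d) = s (k + d) + length (p (k + d))"
      by (simp add: s_def)
    moreover have "u (k + Suc d) ! (length (p (k + d)) + j) = u (k + d) ! j"
      if "j < length (u (k + d))" for j
      using that by (simp add: step nth_append)
    ultimately show ?case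
      using Suc len by (smt (verit) add.commute add.left_commute Nat.add_diff_assoc2 le_add1 order_trans)
  qed simp
  \<comment> \<open>Position \<open>i\<close> is covered from stage \<open>\<bar>i\<bar> + 1\<close> on, since each stage adds a letter on both sides.\<close>
  define x where "x i = u (nat \<bar>i\<bar> + 1) ! nat (i + int (s (nat \<bar>i\<bar> + 1)))" for i
  have agree: "x (int i - int (s k)) = u k ! i" if i: "i < length (u k)" for i k
  proof -
    define z where "z = int i - int (s k)"
    define m where "m = nat \<bar>z\<bar> + 1"
    define j where "j = nat (z + int (s m))"
    have mz: "int m = \<bar>z\<bar> + 1" by (simp add: m_def)
    have j: "int j = z + int (s m)"
      using s_ge[of m] mz unfolding j_def by linarith
    have jl: "j < length (u m)"
      using j e_ge[of m] mz by linarith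
    have "u m ! j = u k ! i"
    proof (cases "k \<le> m")
      case True
      then obtain d where d: "m = k + d" by (metis le_iff_add)
      have "j = i + (s (k + d) - s k)"
        using j coherent[OF i, of d] unfolding z_def d by linarith
      then show ?thesis using coherent[OF i, of d] d by (simp only:)
    next
      case False
      then obtain d where d: "k = m + d" by (metis le_iff_add nat_le_linear)
      have "i = j + (s (m + d) - s m)"
        using j coherent[OF jl, of d] unfolding z_def d by linarith
      then show ?thesis using coherent[OF jl, of d] d by (simp only:)
    qed
    then show ?thesis
      by (simp add: x_def m_def j_def flip: z_def)
  qed
  have win: "window x (- int (s k)) (length (u k)) = u k" for k
    by (intro nth_equalityI) (auto simp: nth_window agree)
  show ?thesis
  proof (rule that[of x "\<lambda>k. - int (s k)"])
    fix l n
    define k where "k = nat (\<bar>l\<bar> + int n)"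
    have "sublist (window x l n) (window x (- int (s k)) (length (u k)))"
    proof (rule sublist_window)
      have "int k = \<bar>l\<bar> + int n"
        by (simp add: k_def)
      then show "- int (s k) \<le> l" "l + int n \<le> - int (s k) + int (length (u k))"
        using s_ge[of k] e_ge[of k] by linarith+
    qed
    then show "\<exists>k. sublist (window x l n) (u k)"
      unfolding win by blast
  qed (rule win)
qed

text \<open>
  A word of a factorial language need not occur in any point; two-sided extendability is what
  allows one to grow it to a point.
\<close>

lemma language_shift_words:
  assumes factorial: "\<And>u v. sublist u v \<Longrightarrow> v \<in> F \<Longrightarrow> u \<in> F"
    and extend: "\<And>u. u \<in> F \<Longrightarrow> \<exists>e f. e # u @ [f] \<in> F"
  shows "words n (language_shift F) = {u \<in> F. length u = n}"
proof (intro equalityI subsetI)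
  fix v assume v: "v \<in> {u \<in> F. length u = n}"
  obtain e f where ef: "\<And>u. u \<in> F \<Longrightarrow> e u # u @ [f u] \<in> F"
    using extend by metis
  define u where "u = rec_nat v (\<lambda>_ w. e w # w @ [f w])"
  have uF: "u k \<in> F" for k
    by (induction k) (use v ef in \<open>auto simp: u_def\<close>)
  obtain x off where x: "\<And>k. window x (off k) (length (u k)) = u k"
      "\<And>l n. \<exists>k. sublist (window x l n) (u k)"
    by (rule nested_words_limit[of u "\<lambda>k. [e (u k)]" "\<lambda>k. [f (u k)]"]) (auto simp: u_def)
  have "x \<in> language_shift F"
    using x(2) uF factorial by (fastforce simp: language_shift_def)
  moreover have "window x (off 0) n = v"
    using x(1)[of 0] v by (simp add: u_def)
  ultimately show "v \<in> words n (language_shift F)"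
    using window_in_words by blast
qed (auto simp: words_eq language_shift_def)

section \<open>The metric and completeness of the space of subshifts\<close>

text \<open>
  Words of length \<open>m\<close> determine all shorter ones, so the metric compares the languages up to a
  single length.  All topological arguments below go through this reformulation.
\<close>

lemma subshift_dist_less_iff:
  assumes "X \<in> subshifts" "Y \<in> subshifts"
  shows "subshift_dist X Y < 2 powr - real m \<longleftrightarrow> words m X = words m Y"
proof (cases "X = Y")
  case False
  let ?D = "{n. words n X \<noteq> words n Y}"
  have ne: "?D \<noteq> {}"
    using words_determine_subshift[OF assms] False by blast
  have "words m X = words m Y \<longleftrightarrow> m < Inf ?D"
  proof
    assume "words m X = words m Y"
    then have "m < n" if "n \<in> ?D" for n
      using words_mono_eq[of m X Y n] that by force
    then show "m < Inf ?D"
      using Inf_nat_def1[OF ne] by blast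
  next
    assume "m < Inf ?D"
    then show "words m X = words m Y"
      using cInf_lower[of m ?D] by fastforce
  qed
  with False show ?thesis
    by (simp add: subshift_dist_def)
qed (simp add: subshift_dist_def)

lemma ex_power_less: "0 < \<epsilon> \<Longrightarrow> \<exists>m. 2 powr - real m < \<epsilon>"
  using real_arch_pow_inv[of \<epsilon> "1/2"]
  by (simp add: powr_minus powr_realpow power_one_over inverse_eq_divide)

lemma openin_subshift_topology_iff:
  "openin subshift_topology U \<longleftrightarrow>
     U \<subseteq> subshifts \<and> (\<forall>X\<in>U. \<exists>m. \<forall>Y\<in>subshifts. words m X = words m Y \<longrightarrow> Y \<in> U)"
proof -
  have "(\<exists>r>0. subshift_space.mball X r \<subseteq> U) \<longleftrightarrow>
      (\<exists>m. \<forall>Y\<in>subshifts. words m X = words m Y \<longrightarrow> Y \<in> U)" if X: "X \<in> subshifts" for X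
  proof
    assume "\<exists>r>0. subshift_space.mball X r \<subseteq> U"
    then obtain r where r: "r > 0" "subshift_space.mball X r \<subseteq> U"
      by blast
    obtain m where "2 powr - real m < r"
      using ex_power_less[OF r(1)] by blast
    then have "Y \<in> U" if "Y \<in> subshifts" "words m X = words m Y" for Y
      using subshift_dist_less_iff[OF X that(1), of m] that r(2) X
      by (auto simp: subshift_space.mball_def)
    then show "\<exists>m. \<forall>Y\<in>subshifts. words m X = words m Y \<longrightarrow> Y \<in> U"
      by blast
  next
    assume "\<exists>m. \<forall>Y\<in>subshifts. words m X = words m Y \<longrightarrow> Y \<in> U"
    then obtain m where m: "\<forall>Y\<in>subshifts. words m X = words m Y \<longrightarrow> Y \<in> U"
      by blast
    then have "subshift_space.mball X (2 powr - real m) \<subseteq> U"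
      using subshift_dist_less_iff[of X _ m] by (auto simp: subshift_space.mball_def)
    then show "\<exists>r>0. subshift_space.mball X r \<subseteq> U"
      by (intro exI[of _ "2 powr - real m"]) simp
  qed
  then show ?thesis
    unfolding subshift_space.openin_mtopology by blast
qed

lemma in_closure_subshift_topology_iff:
  assumes "X \<in> subshifts" "S \<subseteq> subshifts"
  shows "X \<in> subshift_topology closure_of S \<longleftrightarrow> (\<forall>m. \<exists>Y\<in>S. words m X = words m Y)"
proof
  assume X: "X \<in> subshift_topology closure_of S"
  show "\<forall>m. \<exists>Y\<in>S. words m X = words m Y"
  proof
    fix m
    have "openin subshift_topology {Y \<in> subshifts. words m X = words m Y}"
      unfolding openin_subshift_topology_iff by auto
    moreover have "X \<in> {Y \<in> subshifts. words m X = words m Y}"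
      using assms(1) by blast
    ultimately obtain Y where "Y \<in> S" "Y \<in> {Y \<in> subshifts. words m X = words m Y}"
      using X unfolding in_closure_of by meson
    then show "\<exists>Y\<in>S. words m X = words m Y"
      by blast
  qed
next
  assume near: "\<forall>m. \<exists>Y\<in>S. words m X = words m Y"
  have "\<exists>Y\<in>S. Y \<in> U" if "X \<in> U" "openin subshift_topology U" for U
  proof -
    obtain m where "\<forall>Y\<in>subshifts. words m X = words m Y \<longrightarrow> Y \<in> U"
      using \<open>X \<in> U\<close> \<open>openin subshift_topology U\<close>
      unfolding openin_subshift_topology_iff by meson
    then show ?thesis
      using near assms(2) by blast
  qed
  then show "X \<in> subshift_topology closure_of S"
    using assms(1) by (auto simp: in_closure_of)
qed

text \<open>
  Along a Cauchy sequence the words of each length are eventually constant.  The stable languages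
  form one factorial and extendable language, whose shift is the limit.
\<close>

lemma mcomplete_subshifts: "subshift_space.mcomplete"
  unfolding subshift_space.mcomplete_def
proof (intro allI impI)
  fix S assume cauchy: "subshift_space.MCauchy S"
  then have S: "S i \<in> subshifts" for i
    by (auto simp: subshift_space.MCauchy_def)
  have "\<exists>N. \<forall>i\<ge>N. words n (S i) = words n (S N)" for n
  proof -
    obtain N where "\<And>i j. N \<le> i \<Longrightarrow> N \<le> j \<Longrightarrow> subshift_dist (S i) (S j) < 2 powr - real n"
      using cauchy unfolding subshift_space.MCauchy_def
      by (metis powr_gt_zero zero_neq_numeral)
    then show ?thesis
      using subshift_dist_less_iff[OF S S] by blast
  qed
  then obtain N where N: "\<And>n i. N n \<le> i \<Longrightarrow> words n (S i) = words n (S (N n))"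
    by metis
  define F where "F = (\<Union>n. words n (S (N n)))"
  have F_iff: "u \<in> F \<longleftrightarrow> u \<in> words (length u) (S (N (length u)))" for u
    by (auto simp: F_def dest: length_words)
  have F_iff': "u \<in> F \<longleftrightarrow> u \<in> words (length u) (S i)" if "i \<ge> N (length u)" for u i
    using N[OF that] F_iff by simp
  have factorial: "u \<in> F" if "sublist u v" "v \<in> F" for u v
    using F_iff'[of u "max (N (length u)) (N (length v))"]
      F_iff'[of v "max (N (length u)) (N (length v))"] that sublist_words by simp
  have extend: "\<exists>e f. e # u @ [f] \<in> F" if "u \<in> F" for u
  proof -
    let ?i = "max (N (length u)) (N (length u + 2))"
    have "u \<in> words (length u) (S ?i)"
      using F_iff'[of u ?i] that by simp
    then obtain x k where x: "x \<in> S ?i" and "u = window x k (length u)"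
      unfolding words_eq by blast
    then have u: "window x k (length u) = u"
      by simp
    have "window x (k - 1) (1 + length u + 1) = x (k - 1) # u @ [x (k + int (length u))]"
      unfolding window_add by (simp add: u) (simp add: window_def add.commute)
    then have "x (k - 1) # u @ [x (k + int (length u))] \<in> words (length u + 2) (S ?i)"
      using window_in_words[OF x, of "k - 1" "length u + 2"] by simp
    then have "x (k - 1) # u @ [x (k + int (length u))] \<in> F"
      by (subst F_iff'[of _ ?i]) simp_all
    then show ?thesis by blast
  qed
  let ?X = "language_shift F"
  have words_X: "words n ?X = words n (S (N n))" for n
  proof -
    have "words n ?X = {u \<in> F. length u = n}"
      by (rule language_shift_words) (use factorial extend in blast)+
    also have "\<dots> = words n (S (N n))"
      using F_iff length_words by blast
    finally show ?thesis .
  qed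
  have "?X \<in> subshifts"
  proof (rule language_shift_subshift)
    let ?A = "\<Union>(set ` words 1 (S (N 1)))"
    show "finite ?A"
      using finite_words[OF S] by auto
    fix u assume u: "u \<in> F"
    show "set u \<subseteq> ?A"
    proof
      fix c assume "c \<in> set u"
      then have "sublist [c] u"
        by (metis append_Cons append_Nil in_set_conv_decomp sublist_appendI)
      then have "[c] \<in> words 1 (S (N 1))"
        using factorial[OF _ u, of "[c]"] F_iff[of "[c]"] by simp
      then show "c \<in> ?A"
        by force
    qed
  next
    show "?X \<noteq> {}"
    proof -
      have "words 0 (S (N 0)) \<noteq> {}"
        using S[of "N 0"] by (auto simp: words_eq subshifts_def)
      then show ?thesis
        using words_X[of 0] by (auto simp: words_eq)
    qed
  qed
  moreover have "\<exists>n0. \<forall>n\<ge>n0. S n \<in> subshifts \<and> subshift_dist (S n) ?X < \<epsilon>" if "\<epsilon> > 0" for \<epsilon>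
  proof -
    obtain m where "2 powr - real m < \<epsilon>"
      using ex_power_less[OF \<open>\<epsilon> > 0\<close>] by blast
    moreover have "subshift_dist (S n) ?X < 2 powr - real m" if "n \<ge> N m" for n
      using subshift_dist_less_iff[OF S \<open>?X \<in> subshifts\<close>] N[OF that] words_X by simp
    ultimately show ?thesis
      using S by (meson less_trans)
  qed
  ultimately show "\<exists>X. limitin subshift_topology S X sequentially"
    unfolding subshift_space.limit_metric_sequentially by blast
qed

section \<open>Coded subshifts\<close>

definition factors :: "int list set \<Rightarrow> int list set" where
  "factors B = {u. \<exists>bs\<in>lists B. sublist u (concat bs)}"

text \<open>
  Instead of parsing points into blocks, coded subshifts are described by their words: the closure
  of the set of bi-infinite concatenations of elements of \<open>B\<close>, if \<open>B\<close> has a nonempty element.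
\<close>

definition coded :: "int list set \<Rightarrow> (int \<Rightarrow> int) set" where
  "coded B = language_shift (factors B)"

lemma sublist_factors: "sublist u v \<Longrightarrow> v \<in> factors B \<Longrightarrow> u \<in> factors B"
  by (auto simp: factors_def intro: sublist_order.order_trans)

lemma concat_factors: "bs \<in> lists B \<Longrightarrow> concat bs \<in> factors B"
  by (auto simp: factors_def)

lemma factors_extend:
  assumes "a \<in> B" "a \<noteq> []" "u \<in> factors B"
  shows "\<exists>e f. e # u @ [f] \<in> factors B"
proof -
  obtain bs p q where bs: "bs \<in> lists B" "concat bs = p @ u @ q"
    using assms(3) by (auto simp: factors_def sublist_def)
  obtain p' e where p': "a @ p = p' @ [e]"
    using assms(2) by (metis append_is_Nil_conv rev_exhaust)
  obtain f q' where q': "q @ a = f # q'"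
    using assms(2) by (metis append_is_Nil_conv list.exhaust)
  have "concat (a # bs @ [a]) = (a @ p) @ u @ (q @ a)"
    by (simp add: bs(2))
  also have "\<dots> = p' @ (e # u @ [f]) @ q'"
    unfolding p' q' by simp
  finally have "sublist (e # u @ [f]) (concat (a # bs @ [a]))"
    by (metis sublist_appendI)
  moreover have "a # bs @ [a] \<in> lists B"
    using bs(1) assms(1) by simp
  ultimately show ?thesis
    unfolding factors_def by blast
qed

lemma words_coded:
  assumes "a \<in> B" "a \<noteq> []"
  shows "words n (coded B) = {u \<in> factors B. length u = n}"
  unfolding coded_def
  by (rule language_shift_words) (use sublist_factors factors_extend[OF assms] in blast)+

lemma coded_subshift:
  assumes "finite B" "a \<in> B" "a \<noteq> []"
  shows "coded B \<in> subshifts"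
  unfolding coded_def
proof (rule language_shift_subshift)
  show "finite (\<Union>(set ` B))"
    using assms(1) by auto
  show "set u \<subseteq> \<Union>(set ` B)" if "u \<in> factors B" for u
    using that set_mono_sublist by (fastforce simp: factors_def)
  have "[] \<in> words 0 (coded B)"
    unfolding words_coded[OF assms(2,3)] using concat_factors[of "[]" B] by simp
  then show "language_shift (factors B) \<noteq> {}"
    by (auto simp: words_eq coded_def)
qed

text \<open>
  By Bezout's identity, the lengths of concatenations of two blocks of coprime lengths meet every
  residue class.
\<close>

lemma exists_concat_length_mod:
  assumes "a \<in> B" "b \<in> B" "a \<noteq> []" "coprime (length a) (length b)" "n \<ge> 1"
  shows "\<exists>bs\<in>lists B. length (concat bs) mod n = c mod n"
proof -
  obtain x y where xy: "length a * x = length b * y + 1"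
    using bezout_nat[of "length a" "length b"] assms(3,4)
    by (auto simp: coprime_iff_gcd_eq_1)
  obtain n' where n': "n = Suc n'"
    using assms(5) by (cases n) auto
  let ?bs = "replicate (c * x) a @ replicate (c * y * n') b"
  have "length (concat ?bs) = c * (length a * x) + c * y * n' * length b"
    by (simp add: length_concat sum_list_replicate algebra_simps)
  also have "\<dots> = c + n * (c * y * length b)"
    unfolding xy n' by (simp add: algebra_simps)
  finally have "length (concat ?bs) mod n = c mod n"
    by simp
  moreover have "?bs \<in> lists B"
    using assms(1,2) by auto
  ultimately show ?thesis
    by blast
qed

text \<open>
  A single point that shows each concatenation \<open>s\<close> in every residue class modulo \<open>n\<close> has a dense orbit
  under the \<open>n\<close>-th power of the shift.  To reach all classes at once, \<open>s\<close> is followed by a filler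
  such that the two together have length congruent to \<open>1\<close>, and this is repeated \<open>n\<close> times; the
  starting positions of the copies then run through all residues, wherever the first copy lies.
\<close>

lemma totally_transitive_coded:
  assumes "finite B" "a \<in> B" "b \<in> B" "a \<noteq> []" "coprime (length a) (length b)"
  shows "totally_transitive (coded B)"
  unfolding totally_transitive_def
proof (intro allI impI)
  fix n :: nat assume n: "n \<ge> 1"
  define M where "M = concat ` lists B"
  have M_append: "s @ t \<in> M" if "s \<in> M" "t \<in> M" for s t
  proof -
    obtain bs cs where "bs \<in> lists B" "cs \<in> lists B" "s = concat bs" "t = concat cs"
      using \<open>s \<in> M\<close> \<open>t \<in> M\<close> unfolding M_def by blast
    then have "s @ t = concat (bs @ cs)" "bs @ cs \<in> lists B"
      by auto
    then show ?thesis
      unfolding M_def by blast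
  qed
  have M_Nil: "[] \<in> M"
    unfolding M_def by (rule image_eqI[of _ _ "[]"]) auto
  have aM: "a \<in> M"
    unfolding M_def by (rule image_eqI[of _ _ "[a]"]) (use assms(2) in auto)
  have M_replicate: "concat (replicate k s) \<in> M" if "s \<in> M" for s k
    by (induction k) (use that M_append M_Nil in auto)
  have "\<exists>f\<in>M. (length s + length f) mod n = 1 mod n" for s :: "int list"
  proof -
    obtain bs where bs: "bs \<in> lists B" "length (concat bs) mod n = ((n - 1) * length s + 1) mod n"
      using exists_concat_length_mod[OF assms(2,3,4,5) n] by blast
    have "(length s + length (concat bs)) mod n = (length s + ((n - 1) * length s + 1)) mod n"
      using bs(2) by (metis mod_add_right_eq)
    also have "length s + ((n - 1) * length s + 1) = n * length s + 1"
      using n by (cases n) auto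
    finally show ?thesis
      using bs(1) unfolding M_def by (metis imageI mod_mult_self4 add.commute mult.commute)
  qed
  then have "\<forall>s :: int list. \<exists>f. f \<in> M \<and> (length s + length f) mod n = 1 mod n"
    by blast
  from choice[OF this] obtain f :: "int list \<Rightarrow> int list"
    where f': "\<forall>s. f s \<in> M \<and> (length s + length (f s)) mod n = 1 mod n" ..
  then have f: "f s \<in> M" "(length s + length (f s)) mod n = 1 mod n" for s
    by simp_all
  \<comment> \<open>An enumeration of all concatenations; stage \<open>k\<close> of the construction takes care of \<open>t k\<close>.\<close>
  define t where "t = from_nat_into M"
  have t: "t k \<in> M" for k
    unfolding t_def using M_Nil by (intro from_nat_into) auto
  define u where "u = rec_nat [] (\<lambda>k w. a @ w @ (concat (replicate n (t k @ f (t k))) @ a))"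
  have u_Suc: "u (Suc k) = a @ u k @ (concat (replicate n (t k @ f (t k))) @ a)" for k
    by (simp add: u_def)
  have uM: "u k \<in> M" for k
  proof (induction k)
    case 0
    then show ?case using M_Nil by (simp add: u_def)
  next
    case (Suc k)
    then show ?case
      unfolding u_Suc using t f(1) by (intro M_append M_replicate aM)
  qed
  obtain x off where x: "\<And>k. window x (off k) (length (u k)) = u k"
      "\<And>l m. \<exists>k. sublist (window x l m) (u k)"
    by (rule nested_words_limit[of u "\<lambda>_. a" "\<lambda>k. concat (replicate n (t k @ f (t k))) @ a"])
      (use assms(4) u_Suc in auto)
  have "window x l m \<in> factors B" for l m
  proof -
    obtain k where "sublist (window x l m) (u k)"
      using x(2) by blast
    moreover have "u k \<in> factors B"
      using uM[of k] unfolding M_def by (metis imageE concat_factors)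
    ultimately show ?thesis
      by (rule sublist_factors)
  qed
  then have "x \<in> coded B"
    by (simp add: coded_def language_shift_def)
  moreover have "coded B \<subseteq> closure (range (\<lambda>i::int. shift_by (i * int n) x))"
  proof
    fix y assume y: "y \<in> coded B"
    have "U \<inter> range (\<lambda>i::int. shift_by (i * int n) x) \<noteq> {}" if U: "open U" "y \<in> U" for U
    proof -
      obtain K where K: "\<And>z. window z (- int K) (2 * K) = window y (- int K) (2 * K) \<Longrightarrow> z \<in> U"
        using cylinder_neighbourhood[OF U] by blast
      define v where "v = window y (- int K) (2 * K)"
      have "v \<in> factors B"
        using y by (simp add: coded_def language_shift_def v_def)
      then obtain s p q where s: "s \<in> M" "s = p @ v @ q"
        unfolding factors_def M_def sublist_def by blast
      have "countable M"
        by simp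
      then obtain k where k: "t k = s"
        using from_nat_into_surj[OF _ s(1)] unfolding t_def by blast
      define P where "P = off (Suc k) + int (length a) + int (length (u k))"
      define L where "L = length s + length (f s)"
      have at: "window x (P + int (j * L + length p)) (length v) = v" if "j < n" for j
      proof -
        obtain i where i: "n = j + Suc i"
          using \<open>j < n\<close> less_iff_Suc_add by auto
        have eq: "u (Suc k) = (a @ u k @ concat (replicate j (s @ f s)) @ p) @ v @
            (q @ f s @ concat (replicate i (s @ f s)) @ a)"
          unfolding u_Suc k i replicate_add by (simp add: s(2))
        have len: "length (concat (replicate j (s @ f s))) = j * L"
          by (simp add: length_concat sum_list_replicate L_def)
        show ?thesis
          using window_subst[of x "off (Suc k)", OF x(1)[of "Suc k", unfolded eq]] len
          by (simp add: P_def add.assoc)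
      qed
      \<comment> \<open>The copy number \<open>j\<close> that puts the left end of the required window, \<open>K\<close> places to the left of
        the new origin, into the right residue class.\<close>
      define j where "j = nat ((- (P + int (length p) + int K)) mod int n)"
      have j: "j < n" "int j = (- (P + int (length p) + int K)) mod int n"
        using n by (auto simp: j_def nat_less_iff)
      have "int L mod int n = 1 mod int n"
        using f(2)[of s] by (metis L_def zmod_int of_nat_1)
      then have "(int j * int L) mod int n = int j mod int n"
        by (metis mod_mult_right_eq mult.right_neutral)
      then have "(P + int (j * L) + int (length p) + int K) mod int n
          = (int j + (P + int (length p) + int K)) mod int n"
        by (metis (no_types, opaque_lifting) add.assoc add.commute mod_add_right_eq of_nat_mult)
      also have "\<dots> = 0"
        unfolding j(2) by (metis add.left_inverse mod_0 mod_add_left_eq)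
      finally obtain i where i: "P + int (j * L) + int (length p) + int K = int n * i"
        by blast
      then have "- int K + i * int n = P + int (j * L + length p)"
        by (simp add: algebra_simps)
      then have "window (shift_by (i * int n) x) (- int K) (2 * K) = v"
        unfolding window_shift_by using at[OF j(1)] by (simp add: v_def)
      then show ?thesis
        using K unfolding v_def by blast
    qed
    then show "y \<in> closure (range (\<lambda>i::int. shift_by (i * int n) x))"
      unfolding closure_iff_nhds_not_empty by blast
  qed
  ultimately show "\<exists>x\<in>coded B. coded B \<subseteq> closure (range (\<lambda>i::int. shift_by (i * int n) x))"
    by blast
qed

text \<open>
  In a finite transitive subshift all points share a period \<open>n\<close>, so that the \<open>n\<close>-th power of the
  shift is the identity and its dense orbit is a single point.
\<close>

lemma finite_totally_transitive:
  assumes X: "X \<in> subshifts" and "finite X" and tt: "totally_transitive X"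
  shows "\<exists>c. X = {\<lambda>_. c}"
proof -
  obtain x where x: "x \<in> X" "X \<subseteq> closure (range (\<lambda>i::int. shift_by (i * int 1) x))"
    using tt unfolding totally_transitive_def by blast
  have closed_finite: "closed S" if "S \<subseteq> X" for S
  proof -
    have "closed {z}" for z :: "int \<Rightarrow> int"
    proof -
      have "{z} = (\<Inter>i. {y. window y i 1 \<in> {[z i]}})"
        by (auto simp: window_def fun_eq_iff)
      moreover have "closed (\<Inter>i. {y. window y i 1 \<in> {[z i]}})"
        by (intro closed_INT ballI closed_cylinder_set)
      ultimately show ?thesis
        by (simp only:)
    qed
    moreover have "finite S"
      using that \<open>finite X\<close> finite_subset by blast
    ultimately have "closed (\<Union>z\<in>S. {z})"
      by (intro closed_UN) auto
    then show ?thesis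
      by simp
  qed
  have "\<not> inj (\<lambda>i::nat. shift_by (int i) x)"
  proof
    assume "inj (\<lambda>i::nat. shift_by (int i) x)"
    moreover have "range (\<lambda>i::nat. shift_by (int i) x) \<subseteq> X"
      using shift_by_mem_subshift[OF X x(1)] by auto
    ultimately show False
      using \<open>finite X\<close> by (meson finite_imageD finite_subset infinite_UNIV_nat)
  qed
  then obtain i j :: nat where ij: "i < j" "shift_by (int i) x = shift_by (int j) x"
    unfolding inj_def by (metis linorder_neqE_nat)
  define n where "n = j - i"
  have per: "x (l + int n) = x l" for l
    using fun_cong[OF ij(2), of "l - int i"] ij(1)
    by (simp add: shift_by_def n_def of_nat_diff algebra_simps)
  have "n \<ge> 1"
    using ij(1) by (simp add: n_def)
  have orbit: "X \<subseteq> range (\<lambda>i::int. shift_by i x)"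
    using x(2) closure_closed[OF closed_finite[of "range (\<lambda>i::int. shift_by i x)"]]
      shift_by_mem_subshift[OF X x(1)] by auto
  have fix_y: "shift_by (int n) y = y" if "y \<in> X" for y
  proof -
    obtain i where "y = shift_by i x"
      using orbit \<open>y \<in> X\<close> by blast
    then show ?thesis
      using per[of "l + i" for l] by (simp add: shift_by_def fun_eq_iff algebra_simps)
  qed
  have fix_y': "shift_by (i * int n) y = y" if "y \<in> X" for y i
  proof -
    have pos: "shift_by (int k * int n) y = y" for k
    proof (induction k)
      case (Suc k)
      then show ?case
        using shift_by_add[of "int n" "int k * int n" y] fix_y[OF that] by (simp add: algebra_simps)
    qed (simp add: shift_by_0)
    show ?thesis
    proof (cases "i \<ge> 0")
      case True
      then show ?thesis using pos[of "nat i"] by simp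
    next
      case False
      have "shift_by (i * int n) y = shift_by (i * int n) (shift_by (int (nat (-i)) * int n) y)"
        by (simp only: pos)
      also have "\<dots> = shift_by (i * int n + int (nat (-i)) * int n) y"
        by (simp only: shift_by_add)
      also have "\<dots> = y"
        using False by (simp add: shift_by_0)
      finally show ?thesis .
    qed
  qed
  obtain z where z: "z \<in> X" "X \<subseteq> closure (range (\<lambda>i::int. shift_by (i * int n) z))"
    using tt \<open>n \<ge> 1\<close> unfolding totally_transitive_def by blast
  then have "X \<subseteq> closure {z}"
    using fix_y'[OF z(1)] by (simp add: image_constant_conv)
  then have "X = {z}"
    using closure_closed[OF closed_finite[of "{z}"]] z(1) by auto
  then have "shift_by 1 z = z"
    using shift_by_mem_subshift[OF X z(1), of 1] by simp
  then have step: "z (i + 1) = z i" for i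
    by (auto simp: shift_by_def fun_eq_iff)
  have "z i = z 0" for i
    by (induction i rule: int_induct[of _ 0]) (use step step[of "i - 1" for i] in auto)
  then have "z = (\<lambda>_. z 0)"
    by auto
  with \<open>X = {z}\<close> show ?thesis
    by metis
qed

section \<open>Return words of coprime lengths\<close>

text \<open>
  Total transitivity makes \<open>w\<close> occur, in a single point, at positions congruent to \<open>0\<close> and to \<open>d\<close>
  modulo \<open>N\<close>.  The order of the two occurrences cannot be controlled, because orbits are
  two-sided; hence the alternative between \<open>d\<close> and \<open>N - d\<close> for the length of the word that leads
  from one to the other.  The bounds on \<open>d\<close> keep the occurrences from overlapping in either case.
\<close>

lemma return_word:
  assumes X: "X \<in> subshifts" and tt: "totally_transitive X"
    and w: "w \<in> words (length w) X" "w \<noteq> []"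
    and d: "length w \<le> d" "d + length w \<le> N"
  obtains a j where "prefix w a" "a @ w \<in> words (length (a @ w)) X"
    "length a = d + j * N \<or> length a = N - d + j * N"
proof -
  have "N \<ge> 1"
    using d w(2) by (cases w) auto
  then obtain x where x: "x \<in> X" "X \<subseteq> closure (range (\<lambda>i::int. shift_by (i * int N) x))"
    using tt unfolding totally_transitive_def by blast
  obtain y k where "y \<in> X" "w = window y k (length w)"
    using w(1) unfolding words_eq by blast
  then have y: "y \<in> X" "window y k (length w) = w"
    by auto
  have occ: "\<exists>i. window x (e + i * int N) (length w) = w" for e
  proof -
    let ?U = "{z. window z e (length w) = w}"
    have "shift_by (k - e) y \<in> closure (range (\<lambda>i::int. shift_by (i * int N) x)) \<inter> ?U"
      using shift_by_mem_subshift[OF X y(1)] x(2) y(2) by (auto simp: window_shift_by)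
    then have "?U \<inter> range (\<lambda>i::int. shift_by (i * int N) x) \<noteq> {}"
      using open_Int_closure_eq_empty[OF open_cylinder] by blast
    then show ?thesis
      by (auto simp: window_shift_by)
  qed
  have segment: "\<exists>a. length a = l \<and> prefix w a \<and> a @ w \<in> words (length (a @ w)) X"
    if "window x p (length w) = w" "window x (p + int l) (length w) = w" "l \<ge> length w" for p l
  proof (intro exI conjI)
    let ?a = "window x p l"
    have "?a = window x p (length w) @ window x (p + int (length w)) (l - length w)"
      using that(3) by (simp flip: window_add)
    then show "prefix w ?a"
      using that(1) by (metis prefixI)
    have "?a @ w = window x p (l + length w)"
      by (simp add: window_add that(2))
    then show "?a @ w \<in> words (length (?a @ w)) X"
      by (simp add: window_in_words[OF x(1)])
  qed simp
  obtain i i' where i: "window x (i * int N) (length w) = w"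
      and i': "window x (int d + i' * int N) (length w) = w"
    using occ[of 0] occ[of "int d"] by auto
  show ?thesis
  proof (cases "i \<le> i'")
    case True
    define j where "j = nat (i' - i)"
    have "i' = i + int j"
      using True by (simp add: j_def)
    then obtain a where "length a = d + j * N" "prefix w a" "a @ w \<in> words (length (a @ w)) X"
      using segment[of "i * int N" "d + j * N"] i i' d(1) by (force simp: algebra_simps)
    then show ?thesis
      using that by blast
  next
    case False
    define j where "j = nat (i - i' - 1)"
    have "i = i' + 1 + int j"
      using False by (simp add: j_def)
    then obtain a where "length a = N - d + j * N" "prefix w a" "a @ w \<in> words (length (a @ w)) X"
      using segment[of "int d + i' * int N" "N - d + j * N"] i i' d
      by (force simp: algebra_simps of_nat_diff)
    then show ?thesis
      using that by blast
  qed
qed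

text \<open>
  Given one return word of length \<open>l\<close>, a second one is sought with length \<open>1\<close> or \<open>-1\<close> modulo \<open>l\<close>.
  Working modulo \<open>3 l\<close> with distance \<open>l + 1\<close> leaves room for \<open>w\<close> on both sides.
\<close>

lemma coprime_return_words:
  assumes X: "X \<in> subshifts" and tt: "totally_transitive X"
    and w: "w \<in> words (length w) X" "w \<noteq> []"
  obtains a b where "prefix w a" "a @ w \<in> words (length (a @ w)) X"
    "prefix w b" "b @ w \<in> words (length (b @ w)) X" "coprime (length a) (length b)"
proof -
  obtain a where a: "prefix w a" "a @ w \<in> words (length (a @ w)) X"
    by (rule return_word[OF X tt w, of "length w" "2 * length w"]) (simp, simp, blast)
  define l where "l = length a"
  have l: "l \<ge> length w" "length w \<ge> 1"
    using prefix_length_le[OF a(1)] w(2) by (auto simp: l_def Suc_le_eq)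
  have l3: "l + 1 + length w \<le> 3 * l"
    using l by linarith
  obtain b j where b: "prefix w b" "b @ w \<in> words (length (b @ w)) X"
      "length b = l + 1 + j * (3 * l) \<or> length b = 3 * l - (l + 1) + j * (3 * l)"
    by (rule return_word[OF X tt w, of "l + 1" "3 * l"]) (use l in simp, use l3 in simp, blast)
  have "coprime l (length b)"
  proof (rule coprimeI)
    fix g assume g: "g dvd l" "g dvd length b"
    from b(3) show "is_unit g"
    proof
      assume "length b = l + 1 + j * (3 * l)"
      then have "length b = 1 + l * (1 + 3 * j)"
        by (simp add: algebra_simps)
      moreover have "g dvd l * (1 + 3 * j)"
        using g(1) by (rule dvd_mult2)
      ultimately show ?thesis
        using g(2) dvd_add_left_iff[of g "l * (1 + 3 * j)" 1] by simp
    next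
      assume "length b = 3 * l - (l + 1) + j * (3 * l)"
      then have "length b + 1 = l * (2 + 3 * j)"
        using l by (simp add: algebra_simps)
      moreover have "g dvd l * (2 + 3 * j)"
        using g(1) by (rule dvd_mult2)
      ultimately show ?thesis
        using g(2) dvd_add_right_iff[of g "length b" 1] by simp
    qed
  qed
  with a b show ?thesis
    using that by (simp add: l_def)
qed

lemma word_containing_all:
  assumes X: "X \<in> subshifts" and tt: "totally_transitive X"
  obtains w where "w \<in> words (length w) X" "length w \<ge> m" "\<And>u. u \<in> words m X \<Longrightarrow> sublist u w"
proof -
  obtain x where x: "x \<in> X" "X \<subseteq> closure (range (\<lambda>i::int. shift_by (i * int 1) x))"
    using tt unfolding totally_transitive_def by blast
  have "\<exists>k. window x k m = u" if u: "u \<in> words m X" for u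
  proof -
    obtain y where y: "y \<in> X" "window y 0 m = u"
      using u by (auto simp: words_at_origin[OF X])
    then have "{z. window z 0 m = u} \<inter> range (\<lambda>i::int. shift_by (i * int 1) x) \<noteq> {}"
      using x(2) open_Int_closure_eq_empty[OF open_cylinder] by blast
    then show ?thesis
      by (auto simp: window_shift_by)
  qed
  then obtain k where k: "\<And>u. u \<in> words m X \<Longrightarrow> window x (k u) m = u"
    by metis
  have "finite ((\<lambda>u. nat \<bar>k u\<bar>) ` words m X)"
    using finite_words[OF X] by simp
  then obtain K where K: "\<And>u. u \<in> words m X \<Longrightarrow> nat \<bar>k u\<bar> \<le> K"
    unfolding finite_nat_set_iff_bounded_le by blast
  show ?thesis
  proof (rule that)
    let ?w = "window x (- int K) (2 * K + m)"
    show "?w \<in> words (length ?w) X"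
      by (simp add: window_in_words x(1))
    show "sublist u ?w" if "u \<in> words m X" for u
    proof -
      have "sublist (window x (k u) m) ?w"
        using K[OF that] by (intro sublist_window) auto
      then show ?thesis
        by (simp add: k[OF that])
    qed
  qed simp
qed

section \<open>Visit counts\<close>

definition visits :: "(int \<Rightarrow> int) set \<Rightarrow> (int \<Rightarrow> int) \<Rightarrow> nat \<Rightarrow> real" where
  "visits E x N = (\<Sum>i<N. indicator E (shift_by (int i) x))"

definition cylinder :: "nat \<Rightarrow> int list set \<Rightarrow> (int \<Rightarrow> int) set" where
  "cylinder n W = {x. window x 0 n \<in> W}"

text \<open>
  A finite-time substitute for the statement that the measure of \<open>E\<close> differs from \<open>r\<close>.  The time \<open>N\<close>
  is the same for all points, so that for cylinders the words of one length settle the condition,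
  which is therefore open.
\<close>

definition decides :: "(int \<Rightarrow> int) set \<Rightarrow> real \<Rightarrow> (int \<Rightarrow> int) set \<Rightarrow> bool" where
  "decides E r X \<longleftrightarrow>
     (\<exists>N. (\<forall>x\<in>X. r * real N < visits E x N) \<or> (\<forall>x\<in>X. visits E x N < r * real N))"

lemma visits_cylinder: "visits (cylinder n W) x N = (\<Sum>i<N. of_bool (window x (int i) n \<in> W))"
  by (simp add: visits_def cylinder_def indicator_def window_shift_by of_bool_def)

lemma decides_cylinder_cong:
  assumes "decides (cylinder n W) r X" "X \<in> subshifts"
  shows "\<exists>m. \<forall>Y\<in>subshifts. words m X = words m Y \<longrightarrow> decides (cylinder n W) r Y"
proof -
  obtain N where N: "(\<forall>x\<in>X. r * real N < visits (cylinder n W) x N) \<or>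
      (\<forall>x\<in>X. visits (cylinder n W) x N < r * real N)"
    using assms(1) by (auto simp: decides_def)
  have "\<exists>x\<in>X. visits (cylinder n W) x N = visits (cylinder n W) y N"
    if Y: "Y \<in> subshifts" "words (N + n) X = words (N + n) Y" and y: "y \<in> Y" for Y y
  proof -
    have "window y 0 (N + n) \<in> words (N + n) X"
      using Y(2) y window_in_words by blast
    then obtain x where x: "x \<in> X" "window x 0 (N + n) = window y 0 (N + n)"
      unfolding words_at_origin[OF assms(2)] by auto
    have "window x (int i) n = window y (int i) n" if "i < N" for i
      using arg_cong[OF x(2), of "\<lambda>u. take n (drop i u)"] that
      by (simp add: take_drop_window)
    then have "visits (cylinder n W) x N = visits (cylinder n W) y N"
      unfolding visits_cylinder by (intro sum.cong) auto
    then show ?thesis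
      using x(1) by blast
  qed
  with N have "decides (cylinder n W) r Y" if "Y \<in> subshifts" "words (N + n) X = words (N + n) Y" for Y
    using that unfolding decides_def by metis
  then show ?thesis
    by blast
qed

section \<open>Approximation by coded subshifts\<close>

text \<open>
  A factor of a concatenation consists of whole blocks and of at most two incomplete ones at its
  ends; each incomplete block costs at most twice the maximal block length.
\<close>

lemma sum_list_ge_if_blocks:
  fixes V :: "real list set" and u :: "real list" and \<eta> :: real and L :: nat
  assumes block: "\<And>v. v \<in> V \<Longrightarrow> \<eta> * length v \<le> sum_list v"
    and len: "\<And>v. v \<in> V \<Longrightarrow> length v \<le> L"
    and bound: "\<And>v c. v \<in> V \<Longrightarrow> c \<in> set v \<Longrightarrow> \<bar>c\<bar> \<le> 1"
    and \<eta>: "0 \<le> \<eta>" "\<eta> \<le> 1"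
    and vs: "vs \<in> lists V" and u: "sublist u (concat vs)"
  shows "\<eta> * length u - 4 * L \<le> sum_list u"
proof -
  have short: "\<eta> * length u - 2 * L \<le> sum_list u" if "v \<in> V" "sublist u v" for u v :: "real list"
  proof -
    have "\<bar>c\<bar> \<le> 1" if "c \<in> set u" for c
      using bound[OF \<open>v \<in> V\<close>] set_mono_sublist[OF \<open>sublist u v\<close>] that by blast
    then have "- real (length u) \<le> sum_list u"
      by (induction u) (fastforce simp: abs_le_iff)+
    moreover have "length u \<le> L"
      using sublist_length_le[OF \<open>sublist u v\<close>] len[OF \<open>v \<in> V\<close>] by linarith
    moreover have "\<eta> * length u \<le> length u"
      using \<eta> by (simp add: mult_left_le_one_le)
    ultimately show ?thesis
      by linarith
  qed
  have pre: "\<eta> * length u - 2 * L \<le> sum_list u" if "vs \<in> lists V" "prefix u (concat vs)" for u :: "real list" and vs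
    using that
  proof (induction vs arbitrary: u)
    case Nil
    then show ?case by simp
  next
    case (Cons v vs)
    then have "prefix u v \<or> (\<exists>u'. u = v @ u' \<and> prefix u' (concat vs))"
      by (simp add: prefix_append)
    then show ?case
    proof
      assume "prefix u v"
      then show ?thesis
        using short[of v u] Cons.hyps by (simp add: prefix_imp_sublist)
    next
      assume "\<exists>u'. u = v @ u' \<and> prefix u' (concat vs)"
      then obtain u' where "u = v @ u'" "prefix u' (concat vs)"
        by blast
      then show ?thesis
        using Cons.IH[of u'] Cons.hyps block[of v] by (simp add: algebra_simps)
    qed
  qed
  show ?thesis
    using vs u
  proof (induction vs arbitrary: u)
    case Nil
    then show ?case by simp
  next
    case (Cons v vs)
    then consider "sublist u v" | "sublist u (concat vs)"
      | u1 u2 where "u = u1 @ u2" "suffix u1 v" "prefix u2 (concat vs)"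
      by (auto simp: sublist_append)
    then show ?case
    proof cases
      case 1
      then show ?thesis
        using short[of v u] Cons.hyps by simp
    next
      case 2
      then show ?thesis
        using Cons.IH[of u] Cons.hyps by simp
    next
      case 3
      then show ?thesis
        using short[of v u1] pre[of vs u2] Cons.hyps
        by (simp add: suffix_imp_sublist algebra_simps)
    qed
  qed
qed

text \<open>
  The average over a block is bounded below by some \<open>\<eta> > 0\<close>, so in a factor that is long enough
  the contribution of the whole blocks outweighs the boundary terms.
\<close>

lemma sum_list_pos_if_blocks:
  fixes V :: "real list set"
  assumes "finite V" and pos: "\<And>v. v \<in> V \<Longrightarrow> 0 < sum_list v"
    and bound: "\<And>v c. v \<in> V \<Longrightarrow> c \<in> set v \<Longrightarrow> \<bar>c\<bar> \<le> 1"
  obtains N where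
    "\<And>vs u. vs \<in> lists V \<Longrightarrow> sublist u (concat vs) \<Longrightarrow> length u = N \<Longrightarrow> 0 < sum_list u"
proof -
  obtain L where L: "\<And>v. v \<in> V \<Longrightarrow> length v \<le> L"
    using finite_imageI[OF \<open>finite V\<close>, of length] unfolding finite_nat_set_iff_bounded_le by blast
  define \<eta> where "\<eta> = Min (insert 1 ((\<lambda>v. sum_list v / length v) ` V))"
  have len: "length v > 0" if "v \<in> V" for v
    using pos[OF that] by (cases v) auto
  have "\<eta> > 0" "\<eta> \<le> 1"
    using \<open>finite V\<close> pos len by (auto simp: \<eta>_def)
  have "\<eta> * length v \<le> sum_list v" if "v \<in> V" for v
  proof -
    have "\<eta> \<le> sum_list v / length v"
      using \<open>finite V\<close> that by (auto simp: \<eta>_def)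
    then show ?thesis
      using len[OF that] by (simp add: pos_le_divide_eq)
  qed
  then have ge: "\<eta> * length u - 4 * L \<le> sum_list u"
    if "vs \<in> lists V" "sublist u (concat vs)" for vs and u :: "real list"
    using sum_list_ge_if_blocks[of V \<eta> L vs u] L bound \<open>\<eta> > 0\<close> \<open>\<eta> \<le> 1\<close> that by auto
  obtain N where "4 * real L < real N * \<eta>"
    using reals_Archimedean3[OF \<open>\<eta> > 0\<close>] by blast
  then show ?thesis
    using that[of N] ge by (fastforce simp: mult.commute)
qed

text \<open>
  The terms of the visit count of \<open>W\<close> minus \<open>r\<close>, along the positions of a block \<open>b\<close>.  Windows that start
  near the end of \<open>b\<close> reach into the next block; when all blocks begin with \<open>w\<close> and \<open>w\<close> is long
  enough, they are determined by \<open>b @ w\<close>, and deviations become additive under concatenation.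
\<close>

definition deviations :: "nat \<Rightarrow> int list set \<Rightarrow> real \<Rightarrow> int list \<Rightarrow> int list \<Rightarrow> real list" where
  "deviations n W r w b =
     map (\<lambda>i. of_bool (take n (drop i (b @ w)) \<in> W) - r) [0..<length b]"

lemma length_deviations [simp]: "length (deviations n W r w b) = length b"
  by (simp add: deviations_def)

lemma deviations_append:
  assumes "prefix w (c @ w)" "n \<le> length w"
  shows "deviations n W r w (b @ c) = deviations n W r w b @ deviations n W r w c"
proof (rule nth_equalityI)
  fix i assume i: "i < length (deviations n W r w (b @ c))"
  obtain t where t: "c @ w = w @ t"
    using assms(1) by (auto simp: prefix_def)
  show "deviations n W r w (b @ c) ! i = (deviations n W r w b @ deviations n W r w c) ! i"
  proof (cases "i < length b")
    case True
    then have "take n (drop i ((b @ w) @ t)) = take n (drop i (b @ w))"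
      using assms(2) by (subst drop_append) simp
    moreover have "(b @ c) @ w = (b @ w) @ t"
      by (simp add: t)
    ultimately have "take n (drop i ((b @ c) @ w)) = take n (drop i (b @ w))"
      by (simp only:)
    moreover have "deviations n W r w (b @ c) ! i =
        of_bool (take n (drop i ((b @ c) @ w)) \<in> W) - r"
      using i by (simp add: deviations_def del: append_assoc)
    ultimately show ?thesis
      using True by (simp add: deviations_def nth_append)
  next
    case False
    then show ?thesis
      using i by (simp add: deviations_def nth_append)
  qed
qed simp

lemma prefix_concat:
  assumes "\<And>b. b \<in> B \<Longrightarrow> prefix w b" "bs \<in> lists B"
  shows "prefix w (concat bs @ w)"
  using assms by (cases bs) (auto intro: prefix_order.trans)

lemma deviations_concat:
  assumes "\<And>b. b \<in> B \<Longrightarrow> prefix w b" "n \<le> length w" "bs \<in> lists B"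
  shows "deviations n W r w (concat bs) = concat (map (deviations n W r w) bs)"
  using assms(3)
proof (induction bs)
  case Nil
  then show ?case by (simp add: deviations_def)
next
  case (Cons b bs)
  then have "prefix w (concat bs @ w)"
    using prefix_concat[of B w bs] assms(1) by auto
  with Cons show ?case
    using deviations_append[OF _ assms(2)] by simp
qed

lemma sum_deviations_int: "sum_list (deviations n W r w b) + r * length b \<in> \<int>"
proof -
  have "sum_list (deviations n W r w b) =
      (\<Sum>i<length b. of_bool (take n (drop i (b @ w)) \<in> W) - r)"
    by (simp add: deviations_def interv_sum_list_conv_sum_set_nat atLeast0LessThan)
  also have "\<dots> = (\<Sum>i<length b. of_bool (take n (drop i (b @ w)) \<in> W)) - r * length b"
    by (simp add: sum_subtractf mult.commute)
  finally show ?thesis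
    by (auto simp: of_bool_def intro!: Ints_sum)
qed

text \<open>
  This is where total transitivity rules out rational frequencies: if both deviations vanished,
  \<open>r\<close> times each of two coprime lengths would be an integer, and so \<open>r\<close> itself.
\<close>

lemma nonzero_deviation:
  assumes "coprime (length a) (length b)" "0 < r" "r < 1"
  shows "sum_list (deviations n W r w a) \<noteq> 0 \<or> sum_list (deviations n W r w b) \<noteq> 0"
proof (rule ccontr)
  assume "\<not> ?thesis"
  then have int: "r * length a \<in> \<int>" "r * length b \<in> \<int>"
    using sum_deviations_int[of n W r w a] sum_deviations_int[of n W r w b] by simp_all
  have "coprime (int (length a)) (int (length b))"
    using assms(1) by simp
  then obtain x y where "x * int (length a) + y * int (length b) = 1"
    using bezout_int[of "int (length a)" "int (length b)"] by (auto simp: coprime_iff_gcd_eq_1)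
  then have "of_int x * real (length a) + of_int y * real (length b) = 1"
    by (metis of_int_1 of_int_add of_int_mult of_int_of_nat_eq)
  then have "r * (of_int x * real (length a) + of_int y * real (length b)) = r"
    by simp
  then have "r = of_int x * (r * length a) + of_int y * (r * length b)"
    by (simp add: algebra_simps)
  moreover have "of_int x * (r * length a) + of_int y * (r * length b) \<in> \<int>"
    by (rule Ints_add; rule Ints_mult; use int in simp)
  ultimately have "r \<in> \<int>"
    by simp
  then obtain k where "r = of_int k"
    by (rule Ints_cases)
  with assms(2,3) show False
    by simp
qed

text \<open>
  Short factors see at most one seam between two blocks, and across a seam the following block can
  be replaced by its prefix \<open>w\<close>.
\<close>

lemma factors_of_return_words:
  assumes B: "\<And>b. b \<in> B \<Longrightarrow> prefix w b" "\<And>b. b \<in> B \<Longrightarrow> b @ w \<in> words (length (b @ w)) X"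
    and w: "w \<in> words (length w) X"
    and u: "u \<in> factors B" "length u \<le> length w"
  shows "u \<in> words (length u) X"
proof -
  obtain bs where "bs \<in> lists B" "sublist u (concat bs)"
    using u(1) by (auto simp: factors_def)
  then have "bs \<in> lists B" "sublist u (concat bs @ w)"
    by (auto intro: sublist_order.order_trans)
  then show ?thesis
  proof (induction bs)
    case Nil
    then show ?case
      using sublist_words[OF _ w] by simp
  next
    case (Cons b bs)
    then have b: "b \<in> B" and bs: "bs \<in> lists B"
      by auto
    obtain t where t: "concat bs @ w = w @ t"
      using prefix_concat[OF B(1) bs] by (auto simp: prefix_def)
    have "sublist u (b @ concat bs @ w)"
      using Cons.prems by simp
    then consider "sublist u b" | "sublist u (concat bs @ w)"
      | u1 u2 where "u = u1 @ u2" "suffix u1 b" "prefix u2 (concat bs @ w)"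
      unfolding sublist_append[of u b "concat bs @ w"] by blast
    then show ?case
    proof cases
      case 1
      then have "sublist u (b @ w)"
        by (meson sublist_append_rightI sublist_order.order_trans)
      then show ?thesis
        using sublist_words B(2)[OF b] by blast
    next
      case 2
      then show ?thesis
        using Cons.IH bs by blast
    next
      case 3
      then have "prefix u2 w"
        using u(2) t by (auto simp: prefix_append)
      with 3 have "sublist u (b @ w)"
        by (auto simp: suffix_def prefix_def sublist_def) (metis append.assoc)
      then show ?thesis
        using sublist_words B(2)[OF b] by blast
    qed
  qed
qed

lemma infinite_words_nonconstant:
  assumes "infinite X"
  shows "words 1 X \<noteq> words 1 {\<lambda>_. c}"
proof
  assume eq: "words 1 X = words 1 {\<lambda>_. c}"
  have "x = (\<lambda>_. c)" if "x \<in> X" for x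
  proof
    fix i
    have "window x i 1 \<in> words 1 {\<lambda>_. c}"
      using that eq window_in_words by blast
    then show "x i = c"
      by (auto simp: words_eq window_def)
  qed
  then have "X \<subseteq> {\<lambda>_. c}"
    by blast
  then show False
    using assms finite_subset by blast
qed

lemma concat_lists_concat:
  assumes "B \<subseteq> concat ` lists A" "bs \<in> lists B"
  shows "concat bs \<in> concat ` lists A"
  using assms(2)
proof (induction bs)
  case Nil
  then show ?case by (intro image_eqI[of _ _ "[]"]) auto
next
  case (Cons b bs)
  then obtain cs where cs: "cs \<in> lists A" "concat bs = concat cs"
    by auto
  have "b \<in> concat ` lists A"
    using Cons.hyps assms(1) by blast
  then obtain ds where "ds \<in> lists A" "b = concat ds"
    by blast
  with cs show ?case
    by (intro image_eqI[of _ _ "ds @ cs"]) auto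
qed

text \<open>
  The density argument.  Take a word \<open>w\<close> containing all words of length \<open>k\<close> and two return words
  to \<open>w\<close> of coprime lengths.  One of them, \<open>c\<close>, has a visit frequency different from \<open>r\<close>; let \<open>d\<close> be
  the other.  The coded subshift with blocks \<open>c\<close> and \<open>e = c c ... c d\<close> has the same words of length \<open>k\<close>
  and is totally transitive, as the block lengths are still coprime.  With enough copies of \<open>c\<close> in \<open>e\<close>,
  the deviations of both blocks have the same sign, so all long words deviate to the same side of \<open>r\<close>.
\<close>

lemma deciding_approximation:
  assumes X: "X \<in> infinite_totally_transitive" and r: "0 < r" "r < 1"
  shows "\<exists>Y\<in>infinite_totally_transitive. words m X = words m Y \<and> decides (cylinder n W) r Y"
proof -
  have XS: "X \<in> subshifts" and tt: "totally_transitive X" and inf: "infinite X"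
    using X by (auto simp: infinite_totally_transitive_def)
  \<comment> \<open>Long enough for the prescribed words and for the windows of the cylinder; the summand \<open>1\<close>
    gives access to single letters, which separate \<open>X\<close> from constant subshifts.\<close>
  define k where "k = m + n + 1"
  obtain w where w: "w \<in> words (length w) X" "length w \<ge> k" "\<And>u. u \<in> words k X \<Longrightarrow> sublist u w"
    using word_containing_all[OF XS tt, of k] by blast
  have "w \<noteq> []" and nw: "n \<le> length w"
    using w(2) by (auto simp: k_def)
  obtain a b where ab: "prefix w a" "a @ w \<in> words (length (a @ w)) X"
      "prefix w b" "b @ w \<in> words (length (b @ w)) X" "coprime (length a) (length b)"
    by (rule coprime_return_words[OF XS tt w(1) \<open>w \<noteq> []\<close>])
  let ?dev = "\<lambda>b. sum_list (deviations n W r w b)"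
  obtain c d where cd: "{c, d} = {a, b}" "?dev c \<noteq> 0" "coprime (length c) (length d)"
    using nonzero_deviation[OF ab(5) r, of n W w] ab(5)
    by (metis coprime_commute insert_commute)
  have ret: "prefix w v" "v @ w \<in> words (length (v @ w)) X" if "v \<in> {c, d}" for v
    using that ab unfolding cd(1) by blast+
  \<comment> \<open>The sign reduces a negative deviation of \<open>c\<close> to the positive case.\<close>
  define \<epsilon> where "\<epsilon> = sgn (?dev c)"
  have \<epsilon>: "\<bar>\<epsilon>\<bar> = 1" "\<epsilon> * ?dev c > 0"
    using cd(2) by (auto simp: \<epsilon>_def sgn_if)
  obtain M where M: "\<bar>?dev d\<bar> < real M * (\<epsilon> * ?dev c)"
    using reals_Archimedean3[OF \<epsilon>(2)] by blast
  define e where "e = concat (replicate M c @ [d])"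
  define B where "B = {c, e}"
  have e_pieces: "replicate M c @ [d] \<in> lists {c, d}"
    by auto
  have dev_e: "?dev e = real M * ?dev c + ?dev d"
  proof -
    have "deviations n W r w e = concat (map (deviations n W r w) (replicate M c @ [d]))"
      unfolding e_def using ret(1) by (intro deviations_concat[OF _ nw e_pieces])
    moreover have "sum_list (concat (map (deviations n W r w) (replicate k c @ [d]))) =
        real k * ?dev c + ?dev d" for k
      by (induction k) (simp_all add: algebra_simps)
    ultimately show ?thesis
      by (simp only:)
  qed
  have "\<bar>\<epsilon> * ?dev d\<bar> = \<bar>?dev d\<bar>"
    using \<epsilon>(1) by (simp add: abs_mult)
  then have dev_e_pos: "\<epsilon> * ?dev e > 0"
    using M unfolding dev_e by (simp add: algebra_simps)
  have prefix_B: "prefix w v" if "v \<in> B" for v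
    using that ret(1) by (cases M) (auto simp: B_def e_def)
  have cB: "c \<in> B" "e \<in> B" and finB: "finite B" and cne: "c \<noteq> []"
    using ret(1)[of c] \<open>w \<noteq> []\<close> by (auto simp: B_def)
  have cop: "coprime (length c) (length e)"
  proof -
    have "length e = M * length c + length d"
      by (simp add: e_def length_concat sum_list_replicate)
    then show ?thesis
      using cd(3) gcd_add_mult[of "length c" M "length d"] by (simp add: coprime_iff_gcd_eq_1)
  qed
  define Y where "Y = coded B"
  have YS: "Y \<in> subshifts"
    unfolding Y_def by (rule coded_subshift[OF finB cB(1) cne])
  have Ytt: "totally_transitive Y"
    unfolding Y_def by (rule totally_transitive_coded[OF finB cB cne cop])
  have words_k: "words k X = words k Y"
  proof (intro equalityI subsetI)
    fix u assume u: "u \<in> words k X"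
    have "sublist u c"
      using w(3)[OF u] ret(1)[of c] by (meson insertI1 prefix_imp_sublist sublist_order.order_trans)
    then have "u \<in> factors B"
      using sublist_factors[OF _ concat_factors[of "[c]" B]] cB by simp
    then show "u \<in> words k Y"
      using length_words[OF u] unfolding Y_def words_coded[OF cB(1) cne] by simp
  next
    fix u assume "u \<in> words k Y"
    then have u: "u \<in> factors B" "length u = k"
      unfolding Y_def words_coded[OF cB(1) cne] by auto
    obtain bs where "bs \<in> lists B" "sublist u (concat bs)"
      using u(1) by (auto simp: factors_def)
    moreover have "B \<subseteq> concat ` lists {c, d}"
      unfolding B_def
    proof (intro insert_subsetI empty_subsetI)
      show "c \<in> concat ` lists {c, d}"
        by (rule image_eqI[of _ _ "[c]"]) auto
      show "e \<in> concat ` lists {c, d}"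
        unfolding e_def using e_pieces by (rule imageI)
    qed
    ultimately have "u \<in> factors {c, d}"
      using concat_lists_concat[of B "{c, d}" bs] by (auto simp: factors_def)
    then show "u \<in> words k X"
      using factors_of_return_words[OF ret w(1)] u(2) w(2) by blast
  qed
  have "words 1 X = words 1 Y"
    by (rule words_mono_eq[OF words_k]) (simp add: k_def)
  then have "infinite Y"
    using finite_totally_transitive[OF YS _ Ytt] infinite_words_nonconstant[OF inf] by metis
  moreover have "decides (cylinder n W) r Y"
  proof -
    define V where "V = (\<lambda>v. map ((*) \<epsilon>) (deviations n W r w v)) ` B"
    have sum_V: "sum_list (map ((*) \<epsilon>) v) = \<epsilon> * sum_list v" for v
      by (simp add: sum_list_const_mult)
    obtain N where N: "\<And>vs u. vs \<in> lists V \<Longrightarrow> sublist u (concat vs) \<Longrightarrow> length u = N \<Longrightarrow>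
        0 < sum_list u"
    proof (rule sum_list_pos_if_blocks)
      show "finite V"
        using finB by (simp add: V_def)
      show "0 < sum_list v" if "v \<in> V" for v
        using that \<epsilon>(2) dev_e_pos unfolding V_def B_def by (auto simp: sum_V)
      show "\<bar>x\<bar> \<le> 1" if "v \<in> V" "x \<in> set v" for v x
        using that r \<epsilon>(1) by (auto simp: V_def deviations_def abs_mult of_bool_def)
    qed blast
    have "\<epsilon> * (visits (cylinder n W) x N - r * N) > 0" if x: "x \<in> Y" for x
    proof -
      have "window x 0 (N + n) \<in> factors B"
        using x by (simp add: Y_def coded_def language_shift_def)
      then obtain bs p q where bs: "bs \<in> lists B" "concat bs = p @ window x 0 (N + n) @ q"
        unfolding factors_def sublist_def by blast
      let ?s = "concat bs"
      let ?u = "map ((*) \<epsilon>) (take N (drop (length p) (deviations n W r w ?s)))"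
      have "take n (drop (length p + i) (?s @ w)) = window x (int i) n" if "i < N" for i
      proof -
        have "take n (drop (length p + i) (?s @ w)) = take n (drop i (window x 0 (N + n)))"
          unfolding bs(2) using that by simp
        then show ?thesis
          using that by (simp add: take_drop_window)
      qed
      then have "take N (drop (length p) (deviations n W r w ?s)) =
          map (\<lambda>i. of_bool (window x (int i) n \<in> W) - r) [0..<N]"
        by (intro nth_equalityI) (auto simp: deviations_def bs(2))
      then have "sum_list ?u = \<epsilon> * (\<Sum>i<N. of_bool (window x (int i) n \<in> W) - r)"
        and len: "length ?u = N"
        by (simp_all add: sum_distrib_left interv_sum_list_conv_sum_set_nat atLeast0LessThan)
      then have "sum_list ?u = \<epsilon> * (visits (cylinder n W) x N - r * N)"
        by (simp add: visits_cylinder sum_subtractf mult.commute)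
      moreover have "0 < sum_list ?u"
      proof (rule N[OF _ _ len])
        let ?vs = "map (\<lambda>v. map ((*) \<epsilon>) (deviations n W r w v)) bs"
        show "?vs \<in> lists V"
          using bs(1) by (auto simp: V_def)
        have "deviations n W r w ?s = concat (map (deviations n W r w) bs)"
          using prefix_B by (intro deviations_concat[OF _ nw bs(1)])
        then have "concat ?vs = map ((*) \<epsilon>) (deviations n W r w ?s)"
          by (simp add: map_concat comp_def)
        then show "sublist ?u (concat ?vs)"
          by (simp only: map_mono_sublist sublist_take sublist_drop
              sublist_order.order_trans[OF sublist_take sublist_drop])
      qed
      ultimately show ?thesis
        by simp
    qed
    moreover have "\<epsilon> = 1 \<or> \<epsilon> = -1"
      using \<epsilon>(1) by linarith
    ultimately show ?thesis
      unfolding decides_def by (intro exI[of _ N]) auto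
  qed
  ultimately show ?thesis
    using YS Ytt words_mono_eq[OF words_k, of m] unfolding infinite_totally_transitive_def
    by (intro bexI[of _ Y]) (auto simp: k_def)
qed

section \<open>Clopen subsets of a subshift\<close>

definition clopens :: "(int \<Rightarrow> int) set \<Rightarrow> (int \<Rightarrow> int) set set" where
  "clopens X = {E. openin (top_of_set X) E \<and> closedin (top_of_set X) E}"

lemma clopens_subset: "E \<in> clopens X \<Longrightarrow> E \<subseteq> X"
  by (auto simp: clopens_def dest: openin_imp_subset)

lemma algebra_clopens: "algebra X (clopens X)"
  unfolding algebra_iff_Un by (auto simp: clopens_def dest: openin_imp_subset)

lemma cylinder_clopen: "{x \<in> X. window x k n \<in> W} \<in> clopens X"
proof -
  have "{x \<in> X. window x k n \<in> W} = X \<inter> {x. window x k n \<in> W}"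
    by auto
  then show ?thesis
    unfolding clopens_def mem_Collect_eq
    by (simp only: openin_open_Int[OF open_cylinder_set] closedin_closed_Int[OF closed_cylinder_set])
qed

text \<open>
  A clopen set is compact and open, so finitely many cylinders cover it; the longest of their
  windows decides membership.
\<close>

lemma clopen_eq_cylinder:
  assumes X: "X \<in> subshifts" and E: "E \<in> clopens X"
  obtains K W where "finite W" "E = {x \<in> X. window x (- int K) (2 * K) \<in> W}"
proof -
  have "compact X"
    using X by (simp add: subshifts_def)
  obtain U where U: "open U" "E = X \<inter> U"
    using E by (auto simp: clopens_def openin_open)
  obtain C where "closed C" "E = X \<inter> C"
    using E by (auto simp: clopens_def closedin_closed)
  then have "compact E"
    using \<open>compact X\<close> by (simp add: compact_Int_closed)
  have "\<forall>x\<in>E. \<exists>k::nat. \<forall>y. window y (- int k) (2 * k) = window x (- int k) (2 * k) \<longrightarrow> y \<in> U"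
    using cylinder_neighbourhood[OF U(1)] U(2) by (metis IntD2)
  then obtain k :: "(int \<Rightarrow> int) \<Rightarrow> nat" where k: "\<And>x y. x \<in> E \<Longrightarrow>
      window y (- int (k x)) (2 * k x) = window x (- int (k x)) (2 * k x) \<Longrightarrow> y \<in> U"
    by (metis (no_types, lifting))
  let ?C = "\<lambda>x. {y. window y (- int (k x)) (2 * k x) = window x (- int (k x)) (2 * k x)}"
  have "E \<subseteq> (\<Union>x\<in>E. ?C x)"
    by auto
  then obtain T where T: "T \<subseteq> E" "finite T" "E \<subseteq> (\<Union>x\<in>T. ?C x)"
    by (rule compactE_image[OF \<open>compact E\<close> open_cylinder])
  obtain K where K: "\<And>x. x \<in> T \<Longrightarrow> k x \<le> K"
    using finite_imageI[OF T(2), of k] unfolding finite_nat_set_iff_bounded_le by blast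
  let ?W = "(\<lambda>e. window e (- int K) (2 * K)) ` E"
  have "y \<in> E" if "y \<in> X" "e \<in> E" and eq: "window y (- int K) (2 * K) = window e (- int K) (2 * K)"
    for y e
  proof -
    obtain x where x: "x \<in> T" "e \<in> ?C x"
      using T(3) \<open>e \<in> E\<close> by blast
    have "take (2 * k x) (drop (K - k x) (window y (- int K) (2 * K))) =
        take (2 * k x) (drop (K - k x) (window e (- int K) (2 * K)))"
      by (simp only: eq)
    then have "window y (- int (k x)) (2 * k x) = window e (- int (k x)) (2 * k x)"
      using K[OF x(1)] by (simp add: take_drop_window of_nat_diff)
    then have "y \<in> U"
      using k[of x y] x T(1) by auto
    then show ?thesis
      using U(2) \<open>y \<in> X\<close> by blast
  qed
  then have "E = {x \<in> X. window x (- int K) (2 * K) \<in> ?W}"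
    using clopens_subset[OF E] by auto
  moreover have "?W \<subseteq> words (2 * K) X"
    using clopens_subset[OF E] by (auto intro: window_in_words)
  then have "finite ?W"
    using finite_words[OF X] finite_subset by blast
  ultimately show ?thesis
    using that by blast
qed

lemma shift_in_subshift: "X \<in> subshifts \<Longrightarrow> x \<in> X \<Longrightarrow> shift x \<in> X"
  using shift_by_mem_subshift[of X x 1] by (simp add: shift_by_1)

lemma shift_vimage_clopen:
  assumes X: "X \<in> subshifts" and E: "E \<in> clopens X"
  shows "shift -` E \<inter> X \<in> clopens X"
proof -
  obtain K W where W: "E = {x \<in> X. window x (- int K) (2 * K) \<in> W}"
    by (rule clopen_eq_cylinder[OF X E])
  have "shift -` E \<inter> X = {x \<in> X. window x (- int K + 1) (2 * K) \<in> W}"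
  proof -
    have "window (shift x) (- int K) (2 * K) = window x (- int K + 1) (2 * K)" for x
      by (simp add: window_shift_by flip: shift_by_1)
    then show ?thesis
      using shift_in_subshift[OF X] by (auto simp: W)
  qed
  then show ?thesis
    by (simp only: cylinder_clopen)
qed

text \<open>
  Every relatively open set is a countable union of cylinders, because there are only countably
  many words.
\<close>

lemma sets_borel_subshift:
  assumes X: "X \<in> subshifts"
  shows "sets (restrict_space borel X) = sigma_sets X (clopens X)"
proof
  have XB: "X \<in> sets borel"
    using closed_subshift[OF X] by simp
  have "clopens X \<subseteq> sets (restrict_space borel X)"
  proof
    fix E assume "E \<in> clopens X"
    then obtain U where "open U" "E = X \<inter> U"
      unfolding clopens_def openin_open by blast
    then show "E \<in> sets (restrict_space borel X)"
      unfolding sets_restrict_space by (intro image_eqI[of _ _ U]) simp_all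
  qed
  then show "sigma_sets X (clopens X) \<subseteq> sets (restrict_space borel X)"
    using sets.sigma_sets_subset[of "clopens X" "restrict_space borel X"]
    by (simp add: space_restrict_space)
  interpret S: sigma_algebra X "sigma_sets X (clopens X)"
    using clopens_subset by (intro sigma_algebra_sigma_sets) blast
  have "X \<inter> U \<in> sigma_sets X (clopens X)" if U: "open U" for U
  proof -
    let ?I = "{(K::nat, u). {y. window y (- int K) (2 * K) \<in> {u}} \<subseteq> U}"
    let ?C = "\<lambda>(K::nat, u). {x \<in> X. window x (- int K) (2 * K) \<in> {u}}"
    have "X \<inter> U = (\<Union>i\<in>?I. ?C i)"
    proof (intro equalityI subsetI)
      fix x assume x: "x \<in> X \<inter> U"
      then obtain K where "\<And>y. window y (- int K) (2 * K) = window x (- int K) (2 * K) \<Longrightarrow> y \<in> U"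
        using cylinder_neighbourhood[OF U, of x] by blast
      then have "(K, window x (- int K) (2 * K)) \<in> ?I"
        by auto
      moreover have "x \<in> ?C (K, window x (- int K) (2 * K))"
        using x by auto
      ultimately show "x \<in> (\<Union>i\<in>?I. ?C i)"
        by blast
    qed auto
    moreover have "(\<Union>i\<in>?I. ?C i) \<in> sigma_sets X (clopens X)"
    proof (rule S.countable_UN'')
      show "countable ?I"
        by simp
      show "?C i \<in> sigma_sets X (clopens X)" for i
        by (cases i) (simp only: case_prod_conv, rule sigma_sets.Basic, rule cylinder_clopen)
    qed
    ultimately show ?thesis
      by simp
  qed
  then have "sigma_sets X ((\<inter>) X ` {S. open S}) \<subseteq> sigma_sets X (clopens X)"
    by (intro S.sigma_sets_subset) auto
  moreover have "sets (restrict_space borel X) = sigma_sets X ((\<inter>) X ` {S. open S})"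
    using XB sigma_sets_Int[of X UNIV "{S. open S}"]
    by (simp add: sets_restrict_space borel_def)
  ultimately show "sets (restrict_space borel X) \<subseteq> sigma_sets X (clopens X)"
    by simp
qed

section \<open>Visit counts and invariant measures\<close>

lemma visits_add: "visits E x (m + n) = visits E x m + visits E (shift_by (int m) x) n"
proof -
  have "visits E x (m + n) = visits E x m + (\<Sum>i=m..<m + n. indicator E (shift_by (int i) x))"
    unfolding visits_def lessThan_atLeast0 by (rule sum.atLeastLessThan_concat[symmetric]) auto
  also have "(\<Sum>i=m..<m + n. indicator E (shift_by (int i) x) :: real) =
      (\<Sum>i<n. indicator E (shift_by (int (i + m)) x))"
    using sum.shift_bounds_nat_ivl[of "\<lambda>i. indicator E (shift_by (int i) x) :: real" 0 m n]
    by (simp add: add.commute lessThan_atLeast0)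
  finally show ?thesis
    by (simp add: visits_def flip: shift_by_add)
qed

lemma visits_nonneg: "0 \<le> visits E x N"
  by (simp add: visits_def sum_nonneg)

lemma visits_le: "visits E x N \<le> real N"
proof -
  have "visits E x N \<le> (\<Sum>i<N. 1)"
    unfolding visits_def by (intro sum_mono) (simp add: indicator_def)
  then show ?thesis by simp
qed

text \<open>
  A bound at one time that is uniform over an invariant set propagates to all times by cutting the
  orbit into pieces of length \<open>M\<close>; only the last, incomplete piece is lost.
\<close>

lemma visits_lower_bound:
  assumes X: "X \<in> subshifts" and M: "M > 0" "\<And>x. x \<in> X \<Longrightarrow> r * real M \<le> visits E x M"
    and r: "0 \<le> r" "r \<le> 1" and "x \<in> X"
  shows "r * real N - real M \<le> visits E x N"
  using \<open>x \<in> X\<close>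
proof (induction N arbitrary: x rule: less_induct)
  case (less N)
  show ?case
  proof (cases "N < M")
    case True
    have "r * real N \<le> real N"
      using r by (simp add: mult_left_le_one_le)
    with True show ?thesis
      using visits_nonneg[of E x N] by linarith
  next
    case False
    then obtain k where k: "N = M + k"
      by (metis le_iff_add not_less)
    have "r * real k - real M \<le> visits E (shift_by (int M) x) k"
      using less.IH[of k] less.prems shift_by_mem_subshift[OF X] M(1) k by simp
    then show ?thesis
      using M(2)[OF less.prems] by (simp add: k visits_add algebra_simps)
  qed
qed

lemma visits_upper_bound:
  assumes X: "X \<in> subshifts" and M: "M > 0" "\<And>x. x \<in> X \<Longrightarrow> visits E x M \<le> r * real M"
    and r: "0 \<le> r" and "x \<in> X"
  shows "visits E x N \<le> r * real N + real M"
  using \<open>x \<in> X\<close>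
proof (induction N arbitrary: x rule: less_induct)
  case (less N)
  show ?case
  proof (cases "N < M")
    case True
    have "0 \<le> r * real N"
      using r by simp
    with True show ?thesis
      using visits_le[of E x N] by linarith
  next
    case False
    then obtain k where k: "N = M + k"
      by (metis le_iff_add not_less)
    have "visits E (shift_by (int M) x) k \<le> r * real k + real M"
      using less.IH[of k] less.prems shift_by_mem_subshift[OF X] M(1) k by simp
    then show ?thesis
      using M(2)[OF less.prems] by (simp add: k visits_add algebra_simps)
  qed
qed

text \<open>
  The finite-time form of the property to be shown generic: it speaks of finite stretches of orbits
  only, and invariant measures are constructed from it.
\<close>

definition rationally_decided :: "(int \<Rightarrow> int) set \<Rightarrow> bool" where
  "rationally_decided X \<longleftrightarrow> (\<forall>E\<in>clopens X. \<forall>r\<in>\<rat>. 0 < r \<longrightarrow> r < 1 \<longrightarrow> decides E r X)"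

lemma rationally_decidedI:
  assumes X: "X \<in> subshifts"
    and dec: "\<And>n W r. finite W \<Longrightarrow> r \<in> \<rat> \<Longrightarrow> 0 < r \<Longrightarrow> r < 1 \<Longrightarrow> decides (cylinder n W) r X"
  shows "rationally_decided X"
  unfolding rationally_decided_def
proof (intro ballI impI)
  fix E and r :: real assume E: "E \<in> clopens X" and r: "r \<in> \<rat>" "0 < r" "r < 1"
  obtain K W where W: "finite W" "E = {x \<in> X. window x (- int K) (2 * K) \<in> W}"
    by (rule clopen_eq_cylinder[OF X E])
  let ?y = "\<lambda>x. shift_by (- int K) x"
  have "visits E x N = visits (cylinder (2 * K) W) (?y x) N" if "x \<in> X" for x N
    unfolding visits_def
    by (intro sum.cong)
      (auto simp: W(2) cylinder_def window_shift_by shift_by_mem_subshift[OF X that] indicator_def)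
  moreover have "?y x \<in> X" if "x \<in> X" for x
    using shift_by_mem_subshift[OF X that] .
  ultimately show "decides E r X"
    using dec[OF W(1) r, of "2 * K"] unfolding decides_def by metis
qed

lemma decidesE:
  assumes "decides E r X" "X \<noteq> {}"
  obtains (above) N where "N > 0" "\<And>x. x \<in> X \<Longrightarrow> r * real N < visits E x N"
    | (below) N where "N > 0" "\<And>x. x \<in> X \<Longrightarrow> visits E x N < r * real N"
proof -
  obtain x where x: "x \<in> X"
    using assms(2) by blast
  obtain N where "(\<forall>x\<in>X. r * real N < visits E x N) \<or> (\<forall>x\<in>X. visits E x N < r * real N)"
    using assms(1) by (auto simp: decides_def)
  moreover from this have "N > 0"
    using x by (cases N) (auto simp: visits_def)
  ultimately show ?thesis
    using above below by blast
qed

lemma measure_orbit_clopen: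
  assumes X: "X \<in> subshifts" and \<mu>: "invariant_measure X \<mu>" and E: "E \<in> clopens X"
  shows "{x \<in> X. shift_by (int i) x \<in> E} \<in> clopens X \<and>
    measure \<mu> {x \<in> X. shift_by (int i) x \<in> E} = measure \<mu> E"
proof (induction i)
  case 0
  have "{x \<in> X. shift_by (int 0) x \<in> E} = E"
    using clopens_subset[OF E] by (auto simp: shift_by_0)
  then show ?case
    using E by simp
next
  case (Suc i)
  let ?A = "{x \<in> X. shift_by (int i) x \<in> E}"
  have "shift_by (int (Suc i)) x = shift_by (int i) (shift x)" for x
    using shift_by_add[of "int i" 1 x] by (simp add: shift_by_1 add.commute)
  then have eq: "{x \<in> X. shift_by (int (Suc i)) x \<in> E} = shift -` ?A \<inter> X"
    using shift_in_subshift[OF X] by auto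
  have "?A \<in> sets \<mu>"
    using Suc \<mu> sets_borel_subshift[OF X] by (simp add: invariant_measure_def)
  then have "emeasure \<mu> (shift -` ?A \<inter> X) = emeasure \<mu> ?A"
    using \<mu> unfolding invariant_measure_def by blast
  then have "measure \<mu> (shift -` ?A \<inter> X) = measure \<mu> ?A"
    by (simp only: measure_def)
  moreover have "shift -` ?A \<inter> X \<in> clopens X"
    using Suc shift_vimage_clopen[OF X] by blast
  ultimately show ?case
    unfolding eq using Suc by (simp only:)
qed

lemma integral_visits:
  assumes X: "X \<in> subshifts" and \<mu>: "invariant_measure X \<mu>" and E: "E \<in> clopens X"
  shows "integrable \<mu> (\<lambda>x. visits E x N)" "(\<integral>x. visits E x N \<partial>\<mu>) = real N * measure \<mu> E"
proof -
  interpret prob_space \<mu>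
    using \<mu> by (simp add: invariant_measure_def)
  have space: "space \<mu> = X" and sets: "sets \<mu> = sigma_sets X (clopens X)"
    using \<mu> sets_borel_subshift[OF X] by (simp_all add: invariant_measure_def)
  let ?A = "\<lambda>i. {x \<in> X. shift_by (int i) x \<in> E}"
  have A: "?A i \<in> sets \<mu>" for i
    using measure_orbit_clopen[OF X \<mu> E] by (simp add: sets)
  have eq: "visits E x N = (\<Sum>i<N. indicator (?A i) x)" if "x \<in> space \<mu>" for x
    using that by (auto simp: visits_def space indicator_def)
  have int: "integrable \<mu> (indicator (?A i) :: _ \<Rightarrow> real)" for i
    using A[of i] by (intro integrable_real_indicator) (auto simp: emeasure_eq_measure)
  have "integrable \<mu> (\<lambda>x. \<Sum>i<N. indicator (?A i) x :: real)"
    by (intro Bochner_Integration.integrable_sum int)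
  then show "integrable \<mu> (\<lambda>x. visits E x N)"
    by (subst Bochner_Integration.integrable_cong[OF refl eq])
  have "(\<integral>x. visits E x N \<partial>\<mu>) = (\<integral>x. (\<Sum>i<N. indicator (?A i) x) \<partial>\<mu>)"
    by (rule Bochner_Integration.integral_cong[OF refl eq])
  also have "\<dots> = (\<Sum>i<N. \<integral>x. indicator (?A i) x \<partial>\<mu>)"
    by (rule Bochner_Integration.integral_sum) (rule int)
  also have "\<dots> = (\<Sum>i<N. measure \<mu> (?A i))"
    using A sets.sets_into_space by (intro sum.cong) (auto simp: Int_absorb2)
  also have "\<dots> = real N * measure \<mu> E"
    using measure_orbit_clopen[OF X \<mu> E] by simp
  finally show "(\<integral>x. visits E x N \<partial>\<mu>) = real N * measure \<mu> E" .
qed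

text \<open>
  Integrating visit counts: the integral of the number of visits up to time \<open>N\<close> is \<open>N\<close> times the
  measure.  The inequality remains strict, since it is strict at every point.
\<close>

lemma decides_measure:
  assumes X: "X \<in> subshifts" and E: "E \<in> clopens X" and dec: "decides E r X"
  shows "(\<forall>\<mu>. invariant_measure X \<mu> \<longrightarrow> r < measure \<mu> E) \<or>
    (\<forall>\<mu>. invariant_measure X \<mu> \<longrightarrow> measure \<mu> E < r)"
proof -
  have "X \<noteq> {}"
    using X by (simp add: subshifts_def)
  from dec this show ?thesis
  proof (cases rule: decidesE)
    case (above N)
    have "r < measure \<mu> E" if \<mu>: "invariant_measure X \<mu>" for \<mu>
    proof -
      interpret prob_space \<mu>
        using \<mu> by (simp add: invariant_measure_def)
      have "(\<integral>x. r * real N \<partial>\<mu>) < (\<integral>x. visits E x N \<partial>\<mu>)"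
        using above \<mu> by (intro integral_less_AE_space integral_visits[OF X \<mu> E])
          (auto simp: invariant_measure_def emeasure_space_1)
      then show ?thesis
        using above(1) by (simp add: integral_visits[OF X \<mu> E] prob_space mult.commute)
    qed
    then show ?thesis by blast
  next
    case (below N)
    have "measure \<mu> E < r" if \<mu>: "invariant_measure X \<mu>" for \<mu>
    proof -
      interpret prob_space \<mu>
        using \<mu> by (simp add: invariant_measure_def)
      have "(\<integral>x. visits E x N \<partial>\<mu>) < (\<integral>x. r * real N \<partial>\<mu>)"
        using below \<mu> by (intro integral_less_AE_space integral_visits[OF X \<mu> E])
          (auto simp: invariant_measure_def emeasure_space_1)
      then show ?thesis
        using below(1) by (simp add: integral_visits[OF X \<mu> E] prob_space mult.commute)
    qed
    then show ?thesis by blast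
  qed
qed

text \<open>
  If two invariant measures gave different values to a clopen set, a rational number between them
  would be undecided.
\<close>

lemma invariant_measure_unique:
  assumes X: "X \<in> subshifts" and dec: "rationally_decided X"
    and \<mu>: "invariant_measure X \<mu>" and \<nu>: "invariant_measure X \<nu>"
  shows "\<mu> = \<nu>"
proof -
  have le: "measure \<mu> E \<le> measure \<nu> E"
    if \<mu>: "invariant_measure X \<mu>" and \<nu>: "invariant_measure X \<nu>" and E: "E \<in> clopens X" for \<mu> \<nu> E
  proof (rule ccontr)
    assume "\<not> measure \<mu> E \<le> measure \<nu> E"
    then obtain r where r: "r \<in> \<rat>" "measure \<nu> E < r" "r < measure \<mu> E"
      using Rats_dense_in_real[of "measure \<nu> E" "measure \<mu> E"] by auto
    interpret prob_space \<mu>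
      using \<mu> by (simp add: invariant_measure_def)
    have "0 < r" "r < 1"
      using r prob_le_1[of E] measure_nonneg[of \<nu> E] by linarith+
    then have "decides E r X"
      using dec r(1) E by (auto simp: rationally_decided_def)
    then show False
      using decides_measure[OF X E] \<mu> \<nu> r(2,3) by (meson less_asym)
  qed
  interpret P: prob_space \<mu>
    using \<mu> by (simp add: invariant_measure_def)
  interpret Q: prob_space \<nu>
    using \<nu> by (simp add: invariant_measure_def)
  interpret algebra X "clopens X"
    by (rule algebra_clopens)
  show ?thesis
  proof (rule measure_eqI_generator_eq)
    show "Int_stable (clopens X)"
      by (auto simp: Int_stable_def)
    show "clopens X \<subseteq> Pow X"
      using clopens_subset by blast
    show "emeasure \<mu> E = emeasure \<nu> E" if "E \<in> clopens X" for E
      using le[OF \<mu> \<nu> that] le[OF \<nu> \<mu> that]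
      by (simp add: P.emeasure_eq_measure Q.emeasure_eq_measure)
    show "sets \<mu> = sigma_sets X (clopens X)" "sets \<nu> = sigma_sets X (clopens X)"
      using \<mu> \<nu> sets_borel_subshift[OF X] by (simp_all add: invariant_measure_def)
    show "range (\<lambda>_ :: nat. X) \<subseteq> clopens X"
      using top by auto
  qed (auto simp: P.emeasure_eq_measure)
qed

section \<open>Existence of an invariant measure\<close>

text \<open>
  Every rational number is asymptotically either a lower or an upper bound of the frequencies,
  which leaves no gap between their lower and upper limits.
\<close>

lemma convergent_visit_frequency:
  assumes X: "X \<in> subshifts" and dec: "rationally_decided X" and E: "E \<in> clopens X" and x: "x \<in> X"
  shows "convergent (\<lambda>N. visits E x N / real N)"
proof -
  define a where "a N = visits E x N / real N" for N
  have a01: "0 \<le> a N" "a N \<le> 1" for N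
    using visits_nonneg[of E x N] visits_le[of E x N] by (auto simp: a_def divide_le_eq_1)
  have a_eq: "visits E x N = a N * real N" for N
    using visits_le[of E x N] visits_nonneg[of E x N] by (cases "N = 0") (auto simp: a_def)
  \<comment> \<open>The asymptotic lower bounds; \<open>0\<close> is included to have \<open>0 \<le> Sup S\<close> at hand.\<close>
  define S where "S = insert 0 {r. \<forall>u<r. \<forall>\<^sub>F N in sequentially. u < a N}"
  have tail: "\<forall>\<^sub>F N in sequentially. real M / real N < \<epsilon>" if "\<epsilon> > 0" for M \<epsilon>
    using order_tendstoD(2)[OF lim_const_over_n[of "real M"] that] by simp
  have side: "(\<forall>u<r. \<forall>\<^sub>F N in sequentially. u < a N) \<or> (\<forall>u>r. \<forall>\<^sub>F N in sequentially. a N < u)"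
    if r: "r \<in> \<rat>" "0 < r" "r < 1" for r
  proof -
    have "decides E r X" "X \<noteq> {}"
      using dec E r x by (auto simp: rationally_decided_def)
    then show ?thesis
    proof (cases rule: decidesE)
      case (above M)
      have "\<forall>\<^sub>F N in sequentially. u < a N" if "u < r" for u
        using tail[OF diff_gt_0_iff_gt[THEN iffD2, OF that], of M] eventually_gt_at_top[of 0]
      proof (eventually_elim)
        case (elim N)
        have "r * real N - real M \<le> visits E x N"
          by (rule visits_lower_bound[OF X above(1)]) (use above(2) r x in \<open>auto intro: less_imp_le\<close>)
        then show ?case
          using elim by (simp add: a_def field_simps)
      qed
      then show ?thesis by blast
    next
      case (below M)
      have "\<forall>\<^sub>F N in sequentially. a N < u" if "u > r" for u
        using tail[OF diff_gt_0_iff_gt[THEN iffD2, OF that], of M] eventually_gt_at_top[of 0]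
      proof (eventually_elim)
        case (elim N)
        have "visits E x N \<le> r * real N + real M"
          by (rule visits_upper_bound[OF X below(1)]) (use below(2) r x in \<open>auto intro: less_imp_le\<close>)
        then show ?case
          using elim by (simp add: a_def field_simps)
      qed
      then show ?thesis by blast
    qed
  qed
  have S_le: "r \<le> 1" if "r \<in> S" for r
  proof (rule ccontr)
    assume "\<not> r \<le> 1"
    then have "\<forall>\<^sub>F N in sequentially. 1 < a N"
      using that by (auto simp: S_def)
    then obtain N where "1 < a N"
      by (auto simp: eventually_sequentially)
    then show False
      using a01(2)[of N] by simp
  qed
  then have bdd: "bdd_above S"
    by (rule bdd_aboveI)
  define l where "l = Sup S"
  have l0: "0 \<le> l"
    unfolding l_def using bdd by (intro cSup_upper) (auto simp: S_def)
  have "a \<longlonglongrightarrow> l"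
  proof (rule order_tendstoI)
    fix u assume "u < l"
    then obtain r where r: "r \<in> S" "u < r"
      unfolding l_def using less_cSupD[of S u] by (auto simp: S_def)
    show "\<forall>\<^sub>F N in sequentially. u < a N"
    proof (cases "r = 0")
      case True
      then show ?thesis
        using r(2) a01(1) by (intro always_eventually) (auto intro: less_le_trans)
    next
      case False
      then show ?thesis
        using r by (auto simp: S_def)
    qed
  next
    fix u assume u: "l < u"
    show "\<forall>\<^sub>F N in sequentially. a N < u"
    proof (cases "u > 1")
      case True
      then show ?thesis
        using a01(2) by (intro always_eventually) (auto intro: le_less_trans)
    next
      case False
      obtain r where r: "r \<in> \<rat>" "l < r" "r < u"
        using Rats_dense_in_real[OF u] by blast
      then have "r \<notin> S"
        using cSup_upper[OF _ bdd, of r] unfolding l_def by auto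
      moreover have "0 < r" "r < 1"
        using r l0 False by auto
      ultimately show ?thesis
        using side[OF r(1)] r(3) by (auto simp: S_def)
    qed
  qed
  then show ?thesis
    unfolding a_def by (rule convergentI)
qed

text \<open>
  The limit frequencies along one orbit form a finitely additive shift-invariant function on
  clopen sets.  Caratheodory's theorem extends it: a decreasing sequence of clopen sets with empty
  intersection is eventually empty by compactness, so continuity at the empty set is automatic.
\<close>

lemma exists_invariant_measure:
  assumes X: "X \<in> subshifts" and dec: "rationally_decided X"
  shows "\<exists>\<mu>. invariant_measure X \<mu>"
proof -
  obtain x0 where x0: "x0 \<in> X"
    using X by (auto simp: subshifts_def)
  define f where "f E = lim (\<lambda>N. visits E x0 N / real N)" for E
  have f: "(\<lambda>N. visits E x0 N / real N) \<longlonglongrightarrow> f E" if "E \<in> clopens X" for E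
    using convergent_visit_frequency[OF X dec that x0] unfolding f_def convergent_LIMSEQ_iff .
  have f_nonneg: "0 \<le> f E" if "E \<in> clopens X" for E
    by (rule LIMSEQ_le_const[OF f[OF that]]) (auto simp: visits_nonneg)
  have f_empty: "f {} = 0"
    by (simp add: f_def visits_def)
  have f_X: "f X = 1"
  proof -
    have "visits X x0 N = real N" for N
      by (simp add: visits_def shift_by_mem_subshift[OF X x0])
    then have "\<forall>\<^sub>F N in sequentially. visits X x0 N / real N = 1"
      using eventually_gt_at_top[of 0] by (auto elim: eventually_mono)
    then show ?thesis
      unfolding f_def by (intro limI tendsto_eventually)
  qed
  have f_Un: "f (A \<union> B) = f A + f B"
    if "A \<in> clopens X" "B \<in> clopens X" "A \<inter> B = {}" for A B
  proof -
    have "visits (A \<union> B) x0 N = visits A x0 N + visits B x0 N" for N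
      using that(3) by (simp add: visits_def indicator_add sum.distrib flip: sum.distrib)
    then have "(\<lambda>N. visits (A \<union> B) x0 N / real N) \<longlonglongrightarrow> f A + f B"
      using tendsto_add[OF f[OF that(1)] f[OF that(2)]] by (simp add: add_divide_distrib)
    then show ?thesis
      unfolding f_def[of "A \<union> B"] by (rule limI)
  qed
  have f_shift: "f (shift -` E \<inter> X) = f E" if E: "E \<in> clopens X" for E
  proof -
    have eq: "visits (shift -` E \<inter> X) x0 N / real N = visits E x0 N / real N +
        (indicator E (shift_by (int N) x0) - indicator E x0) / real N" for N
    proof -
      have "visits (shift -` E \<inter> X) x0 N = visits E (shift_by (int 1) x0) N"
        unfolding visits_def
        by (intro sum.cong) (auto simp: indicator_def shift_by_mem_subshift[OF X x0]
            shift_by_add[symmetric] add.commute simp flip: shift_by_1)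
      moreover have "visits E x0 (1 + N) = visits E x0 (N + 1)"
        by (simp only: add.commute)
      then have "visits E (shift_by (int 1) x0) N =
          visits E x0 N + (indicator E (shift_by (int N) x0) - indicator E x0)"
        unfolding visits_add by (simp add: visits_def shift_by_0)
      ultimately show ?thesis
        by (simp add: add_divide_distrib)
    qed
    have lim: "(\<lambda>N. (indicator E (shift_by (int N) x0) - indicator E x0) / real N) \<longlonglongrightarrow> 0"
    proof (rule tendsto_rabs_zero_cancel,
        rule tendsto_sandwich[of "\<lambda>_. 0" _ _ "\<lambda>N. 1 / real N"])
      show "\<forall>\<^sub>F N in sequentially.
          \<bar>(indicator E (shift_by (int N) x0) - indicator E x0) / real N\<bar> \<le> 1 / real N"
        by (intro always_eventually allI) (auto simp: indicator_def)
    qed (auto intro: lim_const_over_n)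
    have "(\<lambda>N. visits (shift -` E \<inter> X) x0 N / real N) \<longlonglongrightarrow> f E + 0"
      unfolding eq by (rule tendsto_add[OF f[OF E] lim])
    then show ?thesis
      unfolding f_def[of "shift -` E \<inter> X"] by (intro limI) simp
  qed
  interpret algebra X "clopens X"
    by (rule algebra_clopens)
  define F where "F E = ennreal (f E)" for E
  have "\<exists>m. (\<forall>E\<in>clopens X. m E = F E) \<and> measure_space X (sigma_sets X (clopens X)) m"
  proof (rule caratheodory_empty_continuous)
    show "positive (clopens X) F"
      by (simp add: positive_def F_def f_empty)
    show "additive (clopens X) F"
      by (auto simp: additive_def F_def f_Un f_nonneg ennreal_plus)
    show "F E \<noteq> \<infinity>" for E
      by (simp add: F_def)
    fix A :: "nat \<Rightarrow> _" assume A: "range A \<subseteq> clopens X" "decseq A" "(\<Inter>i. A i) = {}"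
    have "closed (A i)" for i
      using A(1) closed_subshift[OF X] by (auto simp: clopens_def image_subset_iff closedin_closed_eq)
    then have "open (- A i)" for i
      by (simp add: open_Compl)
    moreover have "compact X"
      using X by (simp add: subshifts_def)
    moreover have "X \<subseteq> (\<Union>i\<in>UNIV. - A i)"
      using A(3) by auto
    ultimately obtain T where T: "finite T" "X \<subseteq> (\<Union>i\<in>T. - A i)"
      using compactE_image[of X UNIV "\<lambda>i. - A i"] by metis
    obtain n where n: "\<And>i. i \<in> T \<Longrightarrow> i \<le> n"
      using T(1) unfolding finite_nat_set_iff_bounded_le by blast
    have "A k = {}" if "k \<ge> n" for k
    proof -
      have "A k \<subseteq> A i" if "i \<in> T" for i
        using A(2) n[OF that] \<open>k \<ge> n\<close> by (auto simp: decseq_def)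
      moreover have "A k \<subseteq> X"
        using A(1) clopens_subset by blast
      ultimately show ?thesis
        using T(2) by blast
    qed
    then have "\<forall>\<^sub>F k in sequentially. F (A k) = 0"
      unfolding eventually_sequentially by (intro exI[of _ n]) (simp add: F_def f_empty)
    then show "(\<lambda>i. F (A i)) \<longlonglongrightarrow> 0"
      by (rule tendsto_eventually)
  qed
  then obtain m where m: "\<And>E. E \<in> clopens X \<Longrightarrow> m E = F E"
      "measure_space X (sigma_sets X (clopens X)) m"
    by blast
  define \<mu> where "\<mu> = measure_of X (sigma_sets X (clopens X)) m"
  have sub: "clopens X \<subseteq> Pow X"
    using clopens_subset by blast
  have sub': "sigma_sets X (clopens X) \<subseteq> Pow X"
    using sigma_sets_into_sp[OF sub] by blast
  have space: "space \<mu> = X"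
    unfolding \<mu>_def by (rule space_measure_of[OF sub'])
  have sets: "sets \<mu> = sigma_sets X (clopens X)"
    unfolding \<mu>_def using sets_measure_of[OF sub'] sigma_sets_sigma_sets_eq[OF sub] by simp
  have emeasure: "emeasure \<mu> E = F E" if "E \<in> clopens X" for E
    unfolding \<mu>_def using that m
    by (subst emeasure_measure_of_sigma) (auto simp: measure_space_def)
  have prob: "prob_space \<mu>"
    by (rule prob_spaceI) (simp add: space emeasure top F_def f_X)
  interpret prob_space \<mu>
    by (rule prob)
  have meas: "shift \<in> measurable \<mu> \<mu>"
    by (rule measurable_sigma_sets[OF sets sub])
      (use shift_in_subshift[OF X] shift_vimage_clopen[OF X] in \<open>auto simp: space sets\<close>)
  have "distr \<mu> \<mu> shift = \<mu>"
  proof (rule measure_eqI_generator_eq)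
    show "Int_stable (clopens X)"
      by (auto simp: Int_stable_def)
    show "clopens X \<subseteq> Pow X"
      by (rule sub)
    show "emeasure (distr \<mu> \<mu> shift) E = emeasure \<mu> E" if "E \<in> clopens X" for E
      using that shift_vimage_clopen[OF X that]
      by (simp add: emeasure_distr[OF meas] sets space emeasure F_def f_shift)
    show "range (\<lambda>_ :: nat. X) \<subseteq> clopens X"
      using top by auto
    show "emeasure (distr \<mu> \<mu> shift) X \<noteq> \<infinity>"
      using prob_space.emeasure_space_1[OF prob_space_distr[OF meas]] by (simp add: space)
  qed (auto simp: sets)
  then have "emeasure \<mu> (shift -` A \<inter> X) = emeasure \<mu> A" if "A \<in> sets \<mu>" for A
    using emeasure_distr[OF meas that] by (simp add: space)
  then have "invariant_measure X \<mu>"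
    using prob by (simp add: invariant_measure_def space sets sets_borel_subshift[OF X])
  then show ?thesis
    by blast
qed

lemma rationally_decided_UEI:
  assumes X: "X \<in> subshifts" and dec: "rationally_decided X"
  shows "X \<in> UEI"
proof -
  have unique: "\<exists>!\<mu>. invariant_measure X \<mu>"
    using exists_invariant_measure[OF X dec] invariant_measure_unique[OF X dec] by blast
  let ?\<mu> = "the_invariant_measure X"
  have \<mu>: "invariant_measure X ?\<mu>"
    unfolding the_invariant_measure_def using unique by (rule theI')
  then interpret prob_space ?\<mu>
    by (simp add: invariant_measure_def)
  have "measure ?\<mu> E \<in> {0, 1}" if E: "E \<in> clopens X" "measure ?\<mu> E \<in> \<rat>" for E
  proof (rule ccontr)
    assume "measure ?\<mu> E \<notin> {0, 1}"
    then have "0 < measure ?\<mu> E" "measure ?\<mu> E < 1"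
      using prob_le_1[of E] measure_nonneg[of ?\<mu> E] by (simp_all add: order_less_le)
    then have "decides E (measure ?\<mu> E) X"
      using dec E by (auto simp: rationally_decided_def)
    then show False
      using decides_measure[OF X E(1)] \<mu> by blast
  qed
  then show ?thesis
    using X unique by (auto simp: UEI_def uniquely_ergodic_def clopens_def)
qed

section \<open>Genericity\<close>

theorem corollary6p19:
  shows "residual_in
           (subtopology subshift_topology (subshift_topology closure_of infinite_totally_transitive))
           (UEI \<inter> (subshift_topology closure_of infinite_totally_transitive))"
proof -
  let ?TT = infinite_totally_transitive
  define C where "C = subshift_topology closure_of ?TT"
  let ?T = "subtopology subshift_topology C"
  have TT: "?TT \<subseteq> subshifts"
    by (auto simp: infinite_totally_transitive_def)
  have C_sub: "C \<subseteq> subshifts"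
    unfolding C_def using closure_of_subset_topspace[of subshift_topology ?TT] by simp
  have TT_C: "?TT \<subseteq> C"
    unfolding C_def using TT by (intro closure_of_subset) simp
  have topspace: "topspace ?T = C"
    using C_sub by (simp add: Int_absorb1)
  define D where "D n W r = {X \<in> subshifts. decides (cylinder n W) r X}" for n W r
  have open_D: "openin subshift_topology (D n W r)" for n W r
    unfolding openin_subshift_topology_iff D_def using decides_cylinder_cong by auto
  have dense_D: "?T closure_of (C \<inter> D n W r) = C" if r: "0 < r" "r < 1" for n W r
  proof -
    have "X \<in> subshift_topology closure_of (C \<inter> D n W r)" if X: "X \<in> C" for X
    proof -
      have "\<exists>Y\<in>C \<inter> D n W r. words m X = words m Y" for m
      proof -
        obtain Z where Z: "Z \<in> ?TT" "words m X = words m Z"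
          using X C_sub in_closure_subshift_topology_iff[of X ?TT] TT unfolding C_def by blast
        obtain Y where "Y \<in> ?TT" "words m Z = words m Y" "decides (cylinder n W) r Y"
          using deciding_approximation[OF Z(1) r] by blast
        then show ?thesis
          using Z(2) TT TT_C unfolding D_def by auto
      qed
      then show ?thesis
        using X C_sub by (subst in_closure_subshift_topology_iff) auto
    qed
    then show ?thesis
      by (auto simp: closure_of_subtopology_subset Int_absorb1 closure_of_subtopology
          inf.absorb2 inf_left_idem)
  qed
  define I where "I = {(n :: nat, W :: int list set, r :: real). finite W \<and> r \<in> \<rat> \<and> 0 < r \<and> r < 1}"
  define \<G> where "\<G> = insert C ((\<lambda>(n, W, r). C \<inter> D n W r) ` I)"
  have "countable I"
  proof -
    have "I \<subseteq> UNIV \<times> Collect finite \<times> \<rat>"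
      by (auto simp: I_def)
    moreover have "countable (UNIV \<times> Collect finite \<times> \<rat> :: (nat \<times> int list set \<times> real) set)"
      by (intro countable_SIGMA countable_rat countable_Collect_finite) auto
    ultimately show ?thesis
      by (rule countable_subset)
  qed
  then have countable: "countable \<G>"
    by (simp add: \<G>_def)
  have open_dense: "openin ?T U \<and> ?T closure_of U = topspace ?T" if "U \<in> \<G>" for U
    using that open_D dense_D openin_topspace[of ?T] closure_of_topspace[of ?T]
    unfolding topspace by (auto simp: \<G>_def I_def intro: openin_subtopology_Int2)
  have "completely_metrizable_space ?T"
    by (intro completely_metrizable_space_closedin
        subshift_space.completely_metrizable_space_mtopology mcomplete_subshifts)
      (simp add: C_def)
  then have "?T closure_of (\<Inter>\<G>) = topspace ?T"
    using countable open_dense by (intro Baire_category) auto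
  moreover have "gdelta_in ?T (\<Inter>\<G>)"
    using countable open_dense by (intro gdelta_in_Inter) (auto simp: \<G>_def open_imp_gdelta_in)
  moreover have "\<Inter>\<G> \<subseteq> UEI \<inter> C"
  proof
    fix X assume X: "X \<in> \<Inter>\<G>"
    then have XC: "X \<in> C"
      by (simp add: \<G>_def)
    have "decides (cylinder n W) r X" if "finite W" "r \<in> \<rat>" "0 < r" "r < 1" for n W r
    proof -
      have "(n, W, r) \<in> I"
        using that by (simp add: I_def)
      then have "X \<in> D n W r"
        using X by (force simp: \<G>_def)
      then show ?thesis
        by (simp add: D_def)
    qed
    then have "X \<in> UEI"
      using XC C_sub by (intro rationally_decided_UEI rationally_decidedI) auto
    with XC show "X \<in> UEI \<inter> C"
      by blast
  qed
  ultimately show ?thesis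
    unfolding residual_in_def C_def by blast
qed

end
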